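(* Let $\Theta=(k_1,\cdots,k_n)^t$ be an $n\times 1$ matrix inner function. Then there exists a $1\times n$ matrix function $\Phi$ on $\mathbb T$ such that $\Theta H^2=\ker H_\Phi$.
   Context: $\mathbb T$ is the unit circle, $H^p$ the Hardy spaces, $H^2_{\mathbb C^n}$ column vectors of $n$ functions in $H^2$. An $n\times1$ matrix function $\Theta=(k_1,\dots,k_n)^t$ with $k_i\in H^\infty$ is inner if $|k_1|^2+\cdots+|k_n|^2=1$ a.e. on $\mathbb T$. For a $1\times n$ measurable matrix function $\Phi=[\phi_1,\dots,\phi_n]$ on $\mathbb T$, the kernel of the Hankel operator $H_\Phi$ is $\ker H_\Phi=\{f=(f_1,\dots,f_n)^t\in H^2_{\mathbb C^n}:\ \phi_1f_1+\cdots+\phi_nf_n\in H^1\}$. *)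

theory Defs
  imports "HOL-Analysis.Analysis"
begin

text \<open>Functions on the unit circle T are represented as functions complex => complex,
of which only the values on T matter; T is parametrised by t in [0, 2 pi] via cis t,
with (normalised) Lebesgue measure.\<close>

abbreviation circ_meas :: "real measure" where
  "circ_meas \<equiv> lebesgue_on {0..2*pi}"

definition circ_measurable :: "(complex \<Rightarrow> complex) \<Rightarrow> bool" where
  "circ_measurable f \<longleftrightarrow> (\<lambda>t. f (cis t)) \<in> borel_measurable circ_meas"

definition Lp_circ :: "real \<Rightarrow> (complex \<Rightarrow> complex) \<Rightarrow> bool" where
  "Lp_circ p f \<longleftrightarrow> circ_measurable f \<and>
     integrable circ_meas (\<lambda>t. norm (f (cis t)) powr p)"

definition Linf_circ :: "(complex \<Rightarrow> complex) \<Rightarrow> bool" where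
  "Linf_circ f \<longleftrightarrow> circ_measurable f \<and>
     (\<exists>C. AE t in circ_meas. norm (f (cis t)) \<le> C)"

definition fourier_coeff :: "(complex \<Rightarrow> complex) \<Rightarrow> int \<Rightarrow> complex" where
  "fourier_coeff f n =
     (LINT t|circ_meas. f (cis t) * cis (- (of_int n * t))) / (2 * pi)"

definition hardy :: "real \<Rightarrow> (complex \<Rightarrow> complex) \<Rightarrow> bool" where
  "hardy p f \<longleftrightarrow> Lp_circ p f \<and> (\<forall>n::int. n < 0 \<longrightarrow> fourier_coeff f n = 0)"

definition hardy_inf :: "(complex \<Rightarrow> complex) \<Rightarrow> bool" where
  "hardy_inf f \<longleftrightarrow> Linf_circ f \<and> (\<forall>n::int. n < 0 \<longrightarrow> fourier_coeff f n = 0)"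

definition hardy2_vec :: "('n::finite \<Rightarrow> complex \<Rightarrow> complex) \<Rightarrow> bool" where
  "hardy2_vec F \<longleftrightarrow> (\<forall>i. hardy 2 (F i))"

definition inner_column :: "('n::finite \<Rightarrow> complex \<Rightarrow> complex) \<Rightarrow> bool" where
  "inner_column K \<longleftrightarrow> (\<forall>i. hardy_inf (K i)) \<and>
     (AE t in circ_meas. (\<Sum>i\<in>UNIV. (cmod (K i (cis t)))\<^sup>2) = 1)"

definition mult_range :: "('n::finite \<Rightarrow> complex \<Rightarrow> complex) \<Rightarrow> ('n \<Rightarrow> complex \<Rightarrow> complex) set" where
  "mult_range K = {F. \<exists>g. hardy 2 g \<and>
      (\<forall>i. AE t in circ_meas. F i (cis t) = K i (cis t) * g (cis t))}"

definition hankel_kernel :: "('n::finite \<Rightarrow> complex \<Rightarrow> complex) \<Rightarrow> ('n \<Rightarrow> complex \<Rightarrow> complex) set" where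
  "hankel_kernel Phi = {F. hardy2_vec F \<and> hardy 1 (\<lambda>z. \<Sum>i\<in>UNIV. Phi i z * F i z)}"

end

theory Submission
  imports Defs
begin

text \<open>
  Some entry \<open>k\<^sub>0\<close> of \<open>\<Theta>\<close> is nonzero a.e., because an \<open>H\<^sup>1\<close> function vanishing on a set of positive
  measure is zero. Put \<open>\<Phi> F = F\<^sub>0 / k\<^sub>0 + \<Sum>\<^sub>j 1[B\<^sub>j] (k\<^sub>0 F\<^sub>j - k\<^sub>j F\<^sub>0)\<close> with disjoint open sets \<open>B\<^sub>j\<close>
  that meet the circle and leave an arc \<open>C\<close> uncovered. Then \<open>\<Phi> \<Theta> = 1\<close>. Conversely let \<open>h = \<Phi> F\<close> be in \<open>H\<^sup>1\<close>.
  On \<open>C\<close> one has \<open>F\<^sub>0 = k\<^sub>0 h\<close>, hence everywhere by uniqueness; then on \<open>B\<^sub>j\<close> the minor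
  \<open>k\<^sub>0 F\<^sub>j - k\<^sub>j F\<^sub>0\<close> vanishes, hence everywhere, so \<open>F = \<Theta> h\<close>, and \<open>\<bar>h\<bar> = \<bar>F\<bar>\<close> puts \<open>h\<close> in \<open>H\<^sup>2\<close>.

  The uniqueness theorem: if \<open>F\<close> vanishes on \<open>E\<close>, test it against \<open>exp q\<close> with \<open>q\<close> an analytic
  polynomial such that \<open>Re q\<close> is close to \<open>M 1\<^sub>E\<close>. This gives
  \<open>\<bar>mean F\<bar> exp (M \<bar>E\<bar> / 2\<pi>) \<le> \<integral>\<bar>F\<bar> / 2\<pi>\<close> for all \<open>M\<close>, so the mean of \<open>F\<close> is zero; divide by \<open>z\<close> and repeat.
\<close>

section \<open>Trigonometric polynomials\<close>

interpretation circ: finite_measure circ_meas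
  by (rule finite_measureI) (simp add: emeasure_restrict_space)

lemma measure_circ_meas: "measure circ_meas {0..2*pi} = 2 * pi"
  by (subst measure_restrict_space) auto

lemma continuous_measurable_circ:
  fixes f :: "real \<Rightarrow> 'a::euclidean_space"
  assumes "continuous_on UNIV f"
  shows "f \<in> borel_measurable circ_meas"
  by (rule continuous_imp_measurable_on_sets_lebesgue)
    (use assms in \<open>auto intro: continuous_on_subset\<close>)

lemma cis_measurable_circ [measurable]: "(\<lambda>t. cis (a * t)) \<in> borel_measurable circ_meas"
  by (intro continuous_measurable_circ continuous_intros)

lemma integrable_mult_bounded:
  fixes F G :: "real \<Rightarrow> complex"
  assumes F: "integrable circ_meas F" and G [measurable]: "G \<in> borel_measurable circ_meas"
    and bd: "AE t in circ_meas. norm (G t) \<le> C"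
  shows "integrable circ_meas (\<lambda>t. F t * G t)"
proof (rule Bochner_Integration.integrable_bound)
  show "integrable circ_meas (\<lambda>t. C * norm (F t))" using F by auto
  have [measurable]: "F \<in> borel_measurable circ_meas" using F by auto
  show "(\<lambda>t. F t * G t) \<in> borel_measurable circ_meas" by measurable
  show "AE t in circ_meas. norm (F t * G t) \<le> norm (C * norm (F t))"
    using bd
  proof eventually_elim
    case (elim t)
    then have "norm (F t) * norm (G t) \<le> norm (F t) * C" by (intro mult_left_mono) auto
    then show ?case by (simp add: norm_mult mult.commute)
  qed
qed

lemma integrable_mult_cis [simp, intro]:
  "integrable circ_meas F \<Longrightarrow> integrable circ_meas (\<lambda>t. F t * cis (a * t))"
  by (rule integrable_mult_bounded[where C=1]) auto

lemma integrable_cis [simp, intro]: "integrable circ_meas (\<lambda>t. cis (a * t))"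
  by (rule circ.integrable_const_bound[where B=1]) auto

text \<open>For \<open>n \<noteq> 0\<close> the antiderivative
  \<open>cis (n * t) / (\<i> * n)\<close> takes the same value at both endpoints.\<close>

lemma integral_cis:
  "(LINT t|circ_meas. cis (of_int n * t)) = (if n = 0 then 2 * of_real pi else 0)"
proof (cases "n = 0")
  case True
  then show ?thesis by (simp add: measure_circ_meas scaleR_conv_of_real)
next
  case False
  have i_i: "- (\<i> * (z * \<i>)) = z" for z by (simp add: algebra_simps)
  have "((\<lambda>t. cis (of_int n * t)) has_integral
     (cis (of_int n * (2*pi)) / (\<i> * of_int n) - cis (of_int n * 0) / (\<i> * of_int n))) {0..2*pi}"
    by (rule fundamental_theorem_of_calculus)
      (use False in \<open>auto simp: has_real_derivative_iff_has_vector_derivative[symmetric] cis_conv_exp i_i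
         intro!: derivative_eq_intros has_vector_derivative_real_field\<close>)
  moreover have "cis (of_int n * (2*pi)) = 1"
    by (metis cis_multiple_2pi Ints_of_int mult.commute)
  ultimately have "integral {0..2*pi} (\<lambda>t. cis (of_int n * t)) = 0"
    by (simp add: integral_unique)
  then show ?thesis using False by (simp add: lebesgue_integral_eq_integral)
qed

text \<open>Generated by monomials under sums, so that a statement linear in the polynomial needs
  one induction only; closure under products is derived.\<close>

inductive trig_poly :: "(real \<Rightarrow> complex) \<Rightarrow> bool" where
  monom: "trig_poly (\<lambda>t. c * cis (of_int n * t))"
| add: "trig_poly p \<Longrightarrow> trig_poly q \<Longrightarrow> trig_poly (\<lambda>t. p t + q t)"

lemma trig_poly_const: "trig_poly (\<lambda>t. c)"
  using trig_poly.monom[of c 0] by simp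

lemma trig_poly_cmult: "trig_poly p \<Longrightarrow> trig_poly (\<lambda>t. a * p t)"
proof (induction rule: trig_poly.induct)
  case (monom c n)
  then show ?case using trig_poly.monom[of "a*c" n] by (simp add: mult.assoc)
next
  case (add p q)
  then show ?case by (simp only: ring_distribs) (rule trig_poly.add)
qed

lemma trig_poly_mult:
  assumes "trig_poly p" "trig_poly q"
  shows "trig_poly (\<lambda>t. p t * q t)"
  using assms(1)
proof (induction rule: trig_poly.induct)
  case (monom c n)
  show ?case using assms(2)
  proof (induction rule: trig_poly.induct)
    case (monom d m)
    have "(\<lambda>t. c * cis (of_int n * t) * (d * cis (of_int m * t))) = (\<lambda>t. (c*d) * cis (of_int (n+m) * t))"
      by (simp add: fun_eq_iff cis_mult[symmetric] ring_distribs)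
    then show ?case using trig_poly.monom by metis
  next
    case (add p q)
    then show ?case by (simp only: ring_distribs) (rule trig_poly.add)
  qed
next
  case (add p q)
  then show ?case by (simp only: ring_distribs) (rule trig_poly.add)
qed

lemma trig_poly_continuous: "trig_poly p \<Longrightarrow> continuous_on UNIV p"
  by (induction rule: trig_poly.induct) (auto intro!: continuous_intros)

lemma trig_poly_measurable: "trig_poly p \<Longrightarrow> p \<in> borel_measurable circ_meas"
  by (intro continuous_measurable_circ trig_poly_continuous)

lemma trig_poly_bounded: "trig_poly p \<Longrightarrow> \<exists>C. \<forall>t. norm (p t) \<le> C"
proof (induction rule: trig_poly.induct)
  case (monom c n)
  then show ?case by (intro exI[of _ "norm c"]) (simp add: norm_mult)
next
  case (add p q)
  then obtain C D where "\<forall>t. norm (p t) \<le> C" "\<forall>t. norm (q t) \<le> D" by auto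
  then have "\<forall>t. norm (p t + q t) \<le> C + D" by (meson add_mono norm_triangle_ineq order_trans)
  then show ?case by blast
qed

lemma trig_poly_integrable: "trig_poly p \<Longrightarrow> integrable circ_meas p"
proof -
  assume p: "trig_poly p"
  then obtain C where "\<forall>t. norm (p t) \<le> C" using trig_poly_bounded by blast
  then show ?thesis
    by (intro circ.integrable_const_bound[of _ C] trig_poly_measurable p) auto
qed

lemma integrable_mult_trig_poly:
  "integrable circ_meas F \<Longrightarrow> trig_poly p \<Longrightarrow> integrable circ_meas (\<lambda>t. F t * p t)"
proof -
  assume F: "integrable circ_meas F" and p: "trig_poly p"
  then obtain C where "\<forall>t. norm (p t) \<le> C" using trig_poly_bounded by blast
  then show ?thesis
    by (intro integrable_mult_bounded[of _ _ C] trig_poly_measurable F p) auto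
qed

text \<open>Makes the Stone-Weierstrass theorem for real polynomials in the plane usable on the
  circle. A linear functional becomes \<open>cos t * f 1 + sin t * f \<i>\<close>, and Euler's
  formulas give the coefficients of \<open>cis t\<close> and \<open>cis (- t)\<close>.\<close>

lemma trig_poly_real_polynomial:
  "real_polynomial_function g \<Longrightarrow> trig_poly (\<lambda>t. complex_of_real (g (cis t)))"
proof (induction rule: real_polynomial_function.induct)
  case (linear f)
  then have lin: "linear f" by (rule bounded_linear.linear)
  have "complex_of_real (f (cis t)) =
      (of_real (f 1) - \<i> * of_real (f \<i>)) / 2 * cis (of_int 1 * t)
    + (of_real (f 1) + \<i> * of_real (f \<i>)) / 2 * cis (of_int (-1) * t)" for t
  proof -
    have "cis t = cos t *\<^sub>R 1 + sin t *\<^sub>R \<i>" by (simp add: complex_eq_iff)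
    then have "f (cis t) = cos t * f 1 + sin t * f \<i>"
      by (simp only: linear_add[OF lin] linear_cmul[OF lin] real_scaleR_def)
    then show ?thesis by (simp add: complex_eq_iff) argo
  qed
  then show ?case by (simp only:) (intro trig_poly.intros)
next
  case (const c)
  then show ?case by (rule trig_poly_const)
next
  case (add f g)
  then show ?case by (simp only: of_real_add) (rule trig_poly.add)
next
  case (mult f g)
  then show ?case by (simp only: of_real_mult) (rule trig_poly_mult)
qed

text \<open>Tent functions of the distance to the image of \<open>E\<close> under \<open>cis\<close>
  tend to the indicator, and Stone-Weierstrass replaces each of them by a polynomial. The uniform
  bound 2 serves dominated convergence. Both \<open>E\<close> and \<open>t\<close> stay in the open
  interval, where \<open>cis\<close> is injective.\<close>

lemma trig_poly_approx_indicator: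
  assumes E: "compact E" "E \<subseteq> {0<..<2*pi}"
  obtains p where "\<And>k::nat. trig_poly (p k)" "\<And>k t. norm (p k t) \<le> 2"
    "\<And>t. t \<in> {0<..<2*pi} \<Longrightarrow> (\<lambda>k. p k t) \<longlonglongrightarrow> of_real (indicator E t)"
proof (cases "E = {}")
  \<comment> \<open>The distance to the empty set is 0 by convention, so the tents below would be
    constantly 1 here.\<close>
  case True
  show ?thesis
    by (rule that[of "\<lambda>k t. 0"]) (use True trig_poly_const in auto)
next
  case ne: False
  define S where "S = cis ` E"
  have S: "compact S" "S \<noteq> {}" "closed S"
    unfolding S_def using E ne
    by (auto intro!: compact_continuous_image continuous_intros compact_imp_closed)
  \<comment> \<open>Equal to 1 on \<open>S\<close> and, for \<open>k > 0\<close>, to 0 at distance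
    at least \<open>1 / k\<close> from it.\<close>
  define w :: "nat \<Rightarrow> complex \<Rightarrow> real" where "w k z = max 0 (1 - real k * infdist z S)" for k z
  have w01: "0 \<le> w k z" "w k z \<le> 1" for k z
    by (auto simp: w_def infdist_nonneg)
  have "\<exists>g. real_polynomial_function g \<and> (\<forall>z\<in>sphere 0 1. \<bar>w k z - g z\<bar> < 1 / Suc k)" for k
  proof -
    have "continuous_on (sphere 0 1) (w k)"
      unfolding w_def by (intro continuous_intros)
    then show ?thesis
      using Stone_Weierstrass_real_polynomial_function[of "sphere 0 1" "w k" "1 / Suc k"]
      by (metis compact_sphere of_nat_0_less_iff zero_less_Suc zero_less_divide_1_iff)
  qed
  then obtain g where g: "\<And>k. real_polynomial_function (g k)"
    "\<And>k z. z \<in> sphere 0 1 \<Longrightarrow> \<bar>w k z - g k z\<bar> < 1 / Suc k" by metis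
  have gc: "\<bar>w k (cis t) - g k (cis t)\<bar> < 1 / Suc k" for k t
    by (rule g) simp
  show ?thesis
  proof (rule that[of "\<lambda>k t. complex_of_real (g k (cis t))"])
    show "trig_poly (\<lambda>t. complex_of_real (g k (cis t)))" for k
      using g trig_poly_real_polynomial by blast
    show "norm (complex_of_real (g k (cis t))) \<le> 2" for k t
    proof -
      have "(1::real) / Suc k \<le> 1" by simp
      then show ?thesis using gc[of k t] w01[of k "cis t"] unfolding norm_of_real by linarith
    qed
    fix t :: real assume t: "t \<in> {0<..<2*pi}"
    have mem: "cis t \<in> S \<longleftrightarrow> t \<in> E"
    proof
      assume "cis t \<in> S"
      then obtain s where s: "s \<in> E" "cis t = cis s" by (auto simp: S_def)
      have "Arg2pi (cis s) = s" "Arg2pi (cis t) = t"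
        using s(1) t E by (auto intro!: Arg2pi_unique[of 1] simp: cis_conv_exp subset_eq)
      then show "t \<in> E" using s by simp
    qed (auto simp: S_def)
    have wl: "(\<lambda>k. w k (cis t)) \<longlonglongrightarrow> indicator E t"
    proof (cases "t \<in> E")
      case True
      then have "infdist (cis t) S = 0" using mem by simp
      then show ?thesis using True by (simp add: w_def)
    next
      case False
      then have "infdist (cis t) S > 0"
        using mem S by (metis infdist_pos_not_in_closed)
      moreover have "filterlim (\<lambda>k. real k * infdist (cis t) S) at_top sequentially"
        using calculation by (intro filterlim_at_top_mult_tendsto_pos[OF tendsto_const] filterlim_real_sequentially)
      then have "eventually (\<lambda>k. real k * infdist (cis t) S \<ge> 1) sequentially"
        by (simp add: filterlim_at_top)
      then have "eventually (\<lambda>k. w k (cis t) = 0) sequentially"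
        by eventually_elim (simp add: w_def)
      then show ?thesis using False by (simp add: tendsto_eventually)
    qed
    have "(\<lambda>k. g k (cis t) - w k (cis t)) \<longlonglongrightarrow> 0"
    proof (rule Lim_null_comparison)
      show "\<forall>\<^sub>F k in sequentially. norm (g k (cis t) - w k (cis t)) \<le> 1 / Suc k"
        using gc by (auto intro!: always_eventually less_imp_le simp: abs_minus_commute)
      show "(\<lambda>k. 1 / real (Suc k)) \<longlonglongrightarrow> 0"
        using LIMSEQ_inverse_real_of_nat by (simp add: inverse_eq_divide)
    qed
    from tendsto_add[OF this wl] have "(\<lambda>k. g k (cis t)) \<longlonglongrightarrow> indicator E t" by simp
    then show "(\<lambda>k. complex_of_real (g k (cis t))) \<longlonglongrightarrow> of_real (indicator E t)"
      by (rule tendsto_of_real)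
  qed
qed

section \<open>Approximation and uniqueness of Fourier coefficients\<close>

lemma AE_circ_interior: "AE t in circ_meas. t \<in> {0<..<2*pi}"
proof -
  have "{0, 2*pi} \<in> null_sets circ_meas"
    by (subst null_sets_restrict_space) (auto simp: finite_imp_null_set_lborel[THEN null_sets_completionI])
  then show ?thesis
    by (rule AE_I') auto
qed

text \<open>Inner regularity of Lebesgue measure. The two endpoints form a null set, so discarding
  them costs nothing and brings \<open>E\<close> into the range of
  \<open>trig_poly_approx_indicator\<close>.\<close>

lemma circ_inner_compact:
  assumes A: "A \<in> sets circ_meas" and e: "0 < e"
  obtains E where "compact E" "E \<subseteq> A" "E \<subseteq> {0<..<2*pi}" "E \<in> sets circ_meas"
    "measure circ_meas (A - E) < e"
proof -
  have A': "A \<subseteq> {0..2*pi}" "A \<in> sets lebesgue"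
    using A by (auto simp: sets_restrict_space_iff)
  then have "A \<inter> {0<..<2*pi} \<in> sets lebesgue" by auto
  then obtain E where E: "closed E" "E \<subseteq> A \<inter> {0<..<2*pi}"
      "A \<inter> {0<..<2*pi} - E \<in> lmeasurable"
      "emeasure lebesgue (A \<inter> {0<..<2*pi} - E) < ennreal e"
    using sets_lebesgue_inner_closed e by metis
  have Eb: "bounded E"
    by (rule bounded_subset[of "{0..2*pi}", rotated]) (use E(2) in auto)
  have Es: "E \<in> sets circ_meas"
    using E by (auto simp: sets_restrict_space_iff)
  have null: "{0, 2*pi} \<in> null_sets lebesgue"
    by (auto simp: finite_imp_null_set_lborel[THEN null_sets_completionI])
  have "emeasure circ_meas (A - E) = emeasure lebesgue (A - E)"
    using A' by (subst emeasure_restrict_space) auto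
  also have "\<dots> \<le> emeasure lebesgue ((A \<inter> {0<..<2*pi} - E) \<union> {0, 2*pi})"
    using A' fmeasurableD[OF E(3)] null_setsD2[OF null] by (intro emeasure_mono sets.Un) auto
  also have "\<dots> = emeasure lebesgue (A \<inter> {0<..<2*pi} - E)"
    using E null by (intro emeasure_Un_null_set) auto
  also have "\<dots> < ennreal e" by (rule E)
  finally have "measure circ_meas (A - E) < e"
    using e by (simp add: circ.emeasure_eq_measure ennreal_less_iff)
  then show ?thesis
    using that[of E] E Eb Es by (auto simp: compact_eq_bounded_closed)
qed

text \<open>Dominated convergence with majorant \<open>C * norm (F t)\<close>; the endpoints, where
  no limit is assumed, are null.\<close>

lemma integral_mult_trig_poly_tendsto:
  fixes F :: "real \<Rightarrow> complex"
  assumes F: "integrable circ_meas F"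
    and p: "\<And>k. trig_poly (p k)" "\<And>k t. norm (p k t) \<le> C"
    and E [measurable]: "E \<in> sets circ_meas"
    and lim: "\<And>t. t \<in> {0<..<2*pi} \<Longrightarrow> (\<lambda>k. p k t) \<longlonglongrightarrow> of_real (indicator E t)"
  shows "(\<lambda>k. LINT t|circ_meas. F t * p k t) \<longlonglongrightarrow> (LINT t|circ_meas. F t * of_real (indicator E t))"
proof (rule integral_dominated_convergence)
  have [measurable]: "F \<in> borel_measurable circ_meas" using F by auto
  show "(\<lambda>t. F t * of_real (indicator E t)) \<in> borel_measurable circ_meas" by measurable
  show "(\<lambda>t. F t * p k t) \<in> borel_measurable circ_meas" for k
    using trig_poly_measurable[OF p(1)] by simp
  show "integrable circ_meas (\<lambda>t. C * norm (F t))" using F by auto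
  show "AE t in circ_meas. (\<lambda>k. F t * p k t) \<longlonglongrightarrow> F t * of_real (indicator E t)"
    using AE_circ_interior by eventually_elim (intro tendsto_intros lim)
  show "AE t in circ_meas. norm (F t * p k t) \<le> C * norm (F t)" for k
    using p(2)[of k] by (auto simp: norm_mult mult.commute[of C] intro!: AE_I2 mult_left_mono)
qed

text \<open>Induction over integrable functions: an indicator is approximated through a compact
  subset, sums split the error in halves, and a dominated limit is first replaced by one of its
  approximants.\<close>

lemma trig_poly_dense:
  fixes F :: "real \<Rightarrow> complex"
  assumes "integrable circ_meas F" "0 < e"
  shows "\<exists>p. trig_poly p \<and> (LINT t|circ_meas. norm (F t - p t)) < e"
  using assms
proof (induction arbitrary: e rule: integrable_induct)
  case (base A c)
  \<comment> \<open>The added 1 keeps the denominator positive for \<open>c = 0\<close> and makes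
    the final estimate strict.\<close>
  define e' where "e' = e / (norm c + 1)"
  have e': "e' > 0" using base by (simp add: e'_def add_nonneg_pos)
  obtain E where E: "compact E" "E \<subseteq> A" "E \<subseteq> {0<..<2*pi}" "E \<in> sets circ_meas"
    "measure circ_meas (A - E) < e'"
    using circ_inner_compact[OF base(1) e'] by metis
  note [measurable] = E(4) base(1)
  obtain p where p: "\<And>k::nat. trig_poly (p k)" "\<And>k t. norm (p k t) \<le> 2"
    "\<And>t. t \<in> {0<..<2*pi} \<Longrightarrow> (\<lambda>k. p k t) \<longlonglongrightarrow> of_real (indicator E t)"
    using trig_poly_approx_indicator[OF E(1,3)] by metis
  have "(\<lambda>k. LINT t|circ_meas. norm (indicator A t *\<^sub>R c - c * p k t))
    \<longlonglongrightarrow> (LINT t|circ_meas. norm (indicator A t *\<^sub>R c - c * of_real (indicator E t)))"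
  proof (rule integral_dominated_convergence)
    show "(\<lambda>t. norm (indicator A t *\<^sub>R c - c * of_real (indicator E t))) \<in> borel_measurable circ_meas"
      by measurable
    show "(\<lambda>t. norm (indicator A t *\<^sub>R c - c * p k t)) \<in> borel_measurable circ_meas" for k
      using trig_poly_measurable[OF p(1)] by simp
    \<comment> \<open>One \<open>norm c\<close> comes from the indicator, two from the bound 2 on
      \<open>p k\<close>.\<close>
    show "integrable circ_meas (\<lambda>t. 3 * norm c)" by auto
    show "AE t in circ_meas. (\<lambda>k. norm (indicator A t *\<^sub>R c - c * p k t))
        \<longlonglongrightarrow> norm (indicator A t *\<^sub>R c - c * of_real (indicator E t))"
      using AE_circ_interior by eventually_elim (intro tendsto_intros p)
    show "AE t in circ_meas. norm (norm (indicator A t *\<^sub>R c - c * p k t)) \<le> 3 * norm c" for k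
    proof (rule AE_I2)
      fix t
      have "norm (indicator A t *\<^sub>R c - c * p k t) \<le> norm (indicator A t *\<^sub>R c) + norm (c * p k t)"
        by (rule norm_triangle_ineq4)
      also have "\<dots> \<le> norm c + norm c * 2"
        unfolding norm_mult by (intro add_mono mult_left_mono p) (auto simp: indicator_def)
      finally show "norm (norm (indicator A t *\<^sub>R c - c * p k t)) \<le> 3 * norm c" by simp
    qed
  qed
  moreover have "(LINT t|circ_meas. norm (indicator A t *\<^sub>R c - c * of_real (indicator E t)))
      = (LINT t|circ_meas. norm c * indicator (A - E) t)"
    using E(2) by (intro Bochner_Integration.integral_cong) (auto simp: indicator_def)
  moreover have "\<dots> = norm c * measure circ_meas (A - E)"
  proof -
    have "(A - E) \<inter> {0..2*pi} = A - E" using sets.sets_into_space[OF base(1)] by auto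
    then show ?thesis by simp
  qed
  moreover have "\<dots> < e"
  proof -
    have "norm c * measure circ_meas (A - E) \<le> norm c * e'" using E(5) by (intro mult_left_mono) auto
    also have "\<dots> < (norm c + 1) * e'" using e' by simp
    also have "\<dots> = e" using norm_ge_zero[of c] by (simp add: e'_def add_nonneg_eq_0_iff)
    finally show ?thesis .
  qed
  ultimately have "\<forall>\<^sub>F k in sequentially. (LINT t|circ_meas. norm (indicator A t *\<^sub>R c - c * p k t)) < e"
    by (intro order_tendstoD(2)) (assumption, simp only:)
  then obtain k where "(LINT t|circ_meas. norm (indicator A t *\<^sub>R c - c * p k t)) < e"
    by (auto simp: eventually_sequentially)
  then show ?case using trig_poly_cmult[OF p(1)] by blast
next
  case (add F G)
  obtain p q where p: "trig_poly p" "(LINT t|circ_meas. norm (F t - p t)) < e/2"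
    and q: "trig_poly q" "(LINT t|circ_meas. norm (G t - q t)) < e/2"
    using add.IH(1)[of "e/2"] add.IH(2)[of "e/2"] \<open>0 < e\<close> by auto
  have ip: "integrable circ_meas (\<lambda>t. norm (F t - p t))" "integrable circ_meas (\<lambda>t. norm (G t - q t))"
    using add.hyps p(1) q(1) trig_poly_integrable by auto
  have "(LINT t|circ_meas. norm (F t + G t - (p t + q t))) \<le> (LINT t|circ_meas. norm (F t - p t) + norm (G t - q t))"
    by (intro integral_mono)
      (use ip add.hyps p(1) q(1) trig_poly_integrable in \<open>auto simp: norm_diff_triangle_ineq\<close>)
  also have "\<dots> < e" using p q ip by simp
  finally show ?case using trig_poly.add[OF p(1) q(1)] by blast
next
  case (lim F s)
  have [measurable]: "F \<in> borel_measurable circ_meas" "\<And>i. s i \<in> borel_measurable circ_meas"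
    using lim by auto
  have "(\<lambda>i. LINT t|circ_meas. norm (F t - s i t)) \<longlonglongrightarrow> (LINT t|circ_meas. 0)"
  proof (rule integral_dominated_convergence)
    show "integrable circ_meas (\<lambda>t. 3 * norm (F t))" using lim by auto
    show "AE t in circ_meas. (\<lambda>i. norm (F t - s i t)) \<longlonglongrightarrow> 0"
    proof (rule AE_I2)
      fix t assume "t \<in> space circ_meas"
      then have "(\<lambda>i. s i t) \<longlonglongrightarrow> F t" by (rule lim)
      then have "(\<lambda>i. norm (F t - s i t)) \<longlonglongrightarrow> norm (F t - F t)" by (intro tendsto_intros)
      then show "(\<lambda>i. norm (F t - s i t)) \<longlonglongrightarrow> 0" by simp
    qed
    show "AE t in circ_meas. norm (norm (F t - s i t)) \<le> 3 * norm (F t)" for i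
    proof (rule AE_I2)
      fix t assume "t \<in> space circ_meas"
      then have "norm (s i t) \<le> 2 * norm (F t)" by (rule lim)
      then show "norm (norm (F t - s i t)) \<le> 3 * norm (F t)"
        using norm_triangle_ineq4[of "F t" "s i t"] by simp
    qed
  qed auto
  then have "\<forall>\<^sub>F i in sequentially. (LINT t|circ_meas. norm (F t - s i t)) < e / 2"
    using \<open>0 < e\<close> by (intro order_tendstoD(2)) auto
  then obtain i where i: "(LINT t|circ_meas. norm (F t - s i t)) < e / 2"
    by (auto simp: eventually_sequentially)
  obtain p where p: "trig_poly p" "(LINT t|circ_meas. norm (s i t - p t)) < e/2"
    using lim.IH[of "e/2" i] \<open>0 < e\<close> by auto
  have ip: "integrable circ_meas (\<lambda>t. norm (F t - s i t))" "integrable circ_meas (\<lambda>t. norm (s i t - p t))"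
    using lim.hyps p(1) trig_poly_integrable by auto
  have tri: "norm (F t - p t) \<le> norm (F t - s i t) + norm (s i t - p t)" for t
    using norm_triangle_ineq[of "F t - s i t" "s i t - p t"] by simp
  have "(LINT t|circ_meas. norm (F t - p t)) \<le> (LINT t|circ_meas. norm (F t - s i t) + norm (s i t - p t))"
    by (intro integral_mono)
      (use ip lim.hyps p(1) trig_poly_integrable tri in auto)
  also have "\<dots> < e" using p i ip by simp
  finally show ?case using p(1) by blast
qed

text \<open>Otherwise some compact set of positive measure lies where \<open>G\<close> is positive,
  and the integral over it cannot vanish. Compact sets are the ones that trigonometric polynomials
  reach by approximation.\<close>

lemma AE_nonpos_if_compact_integrals:
  fixes G :: "real \<Rightarrow> real"
  assumes G: "integrable circ_meas G"
    and zero: "\<And>E. compact E \<Longrightarrow> E \<subseteq> {0<..<2*pi} \<Longrightarrow> E \<in> sets circ_meas \<Longrightarrow>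
       (LINT t|circ_meas. G t * indicator E t) = 0"
  shows "AE t in circ_meas. G t \<le> 0"
proof (rule ccontr)
  have [measurable]: "G \<in> borel_measurable circ_meas" using G by auto
  define A where "A = {t \<in> space circ_meas. 0 < G t}"
  have A: "A \<in> sets circ_meas" unfolding A_def by measurable
  assume "\<not> (AE t in circ_meas. G t \<le> 0)"
  then have "emeasure circ_meas A \<noteq> 0"
    using AE_iff_measurable[of A circ_meas "\<lambda>t. G t \<le> 0"] A by (auto simp: A_def not_le)
  then have pos: "measure circ_meas A > 0"
    by (simp add: circ.emeasure_eq_measure zero_less_measure_iff)
  \<comment> \<open>The tolerance is the measure of \<open>A\<close> itself, which forces
    \<open>E\<close> to have positive measure.\<close>
  obtain E where E: "compact E" "E \<subseteq> A" "E \<subseteq> {0<..<2*pi}" "E \<in> sets circ_meas"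
    "measure circ_meas (A - E) < measure circ_meas A"
    using circ_inner_compact[OF A pos] by metis
  note [measurable] = E(4)
  have nn: "AE t in circ_meas. 0 \<le> G t * indicator E t"
    using E(2) by (auto simp: A_def indicator_def intro!: AE_I2)
  have int: "integrable circ_meas (\<lambda>t. G t * indicator E t)"
    using G integrable_mult_indicator[OF E(4) G] by (simp add: mult.commute)
  have "AE t in circ_meas. G t * indicator E t = 0"
    using zero[OF E(1,3,4)] integral_nonneg_eq_0_iff_AE[OF int nn] by simp
  then have "AE t in circ_meas. t \<notin> E"
    by eventually_elim (use E(2) in \<open>auto simp: A_def indicator_def split: if_splits\<close>)
  then have "measure circ_meas E = 0"
    using E(4) by (simp add: AE_iff_measurable[of E] measure_def sets.sets_into_space Int_absorb1
        AE_iff_null_sets[symmetric] null_setsD1)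
  then have "measure circ_meas (A - E) = measure circ_meas A"
    using circ.finite_measure_Diff[OF A E(4,2)] by simp
  then show False using E by simp
qed

text \<open>By linearity \<open>F\<close> annihilates all trigonometric polynomials, hence in the
  limit indicators of compact sets; the preceding lemma then applies to the real and imaginary parts
  with both signs.\<close>

lemma fourier_unique:
  fixes F :: "real \<Rightarrow> complex"
  assumes F: "integrable circ_meas F"
    and zero: "\<And>n::int. (LINT t|circ_meas. F t * cis (of_int n * t)) = 0"
  shows "AE t in circ_meas. F t = 0"
proof -
  have tp: "(LINT t|circ_meas. F t * p t) = 0" if "trig_poly p" for p
    using that
  proof (induction rule: trig_poly.induct)
    case (monom c n)
    have "(LINT t|circ_meas. F t * (c * cis (of_int n * t))) = (LINT t|circ_meas. c * (F t * cis (of_int n * t)))"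
      by (simp add: algebra_simps)
    then show ?case using zero by simp
  next
    case (add p q)
    then show ?case using integrable_mult_trig_poly[OF F] by (simp add: ring_distribs)
  qed
  have E0: "(LINT t|circ_meas. F t * of_real (indicator E t)) = 0"
    if E: "compact E" "E \<subseteq> {0<..<2*pi}" "E \<in> sets circ_meas" for E
  proof -
    obtain p where p: "\<And>k::nat. trig_poly (p k)" "\<And>k t. norm (p k t) \<le> 2"
      "\<And>t. t \<in> {0<..<2*pi} \<Longrightarrow> (\<lambda>k. p k t) \<longlonglongrightarrow> of_real (indicator E t)"
      using trig_poly_approx_indicator[OF E(1,2)] by metis
    have "(\<lambda>k. LINT t|circ_meas. F t * p k t) \<longlonglongrightarrow> (LINT t|circ_meas. F t * of_real (indicator E t))"
      using p E by (intro integral_mult_trig_poly_tendsto[OF F, where C=2]) auto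
    then show ?thesis using tp p(1) LIMSEQ_unique by (auto simp: LIMSEQ_const_iff)
  qed
  have int: "integrable circ_meas (\<lambda>t. F t * of_real (indicator E t))" if "E \<in> sets circ_meas" for E
    using integrable_mult_indicator[OF that F] by (simp add: scaleR_conv_of_real mult.commute)
  have re: "(LINT t|circ_meas. Re (F t) * indicator E t) = 0"
       and im: "(LINT t|circ_meas. Im (F t) * indicator E t) = 0"
    if E: "compact E" "E \<subseteq> {0<..<2*pi}" "E \<in> sets circ_meas" for E
    using E0[OF E] integral_Re[OF int[OF E(3)]] integral_Im[OF int[OF E(3)]] by simp_all
  have "AE t in circ_meas. Re (F t) \<le> 0" "AE t in circ_meas. - Re (F t) \<le> 0"
       "AE t in circ_meas. Im (F t) \<le> 0" "AE t in circ_meas. - Im (F t) \<le> 0"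
    by (intro AE_nonpos_if_compact_integrals; use F re im in \<open>simp add: integrable_Re integrable_Im\<close>)+
  then show ?thesis
    by eventually_elim (auto simp: complex_eq_iff)
qed

section \<open>The uniqueness theorem\<close>

text \<open>The space \<open>H\<^sup>1\<close> in the angular variable; the \<open>m\<close>-th condition is the vanishing of
  the Fourier coefficient of index \<open>-m\<close>.\<close>

definition circ_H1 :: "(real \<Rightarrow> complex) \<Rightarrow> bool" where
  "circ_H1 F \<longleftrightarrow> integrable circ_meas F \<and>
     (\<forall>m::nat. 0 < m \<longrightarrow> (LINT t|circ_meas. F t * cis (of_nat m * t)) = 0)"

lemma circ_H1_integrable: "circ_H1 F \<Longrightarrow> integrable circ_meas F"
  by (simp add: circ_H1_def)

lemma circ_H1_integral: "circ_H1 F \<Longrightarrow> 0 < m \<Longrightarrow> (LINT t|circ_meas. F t * cis (of_nat m * t)) = 0"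
  by (simp add: circ_H1_def)

lemma circ_H1_cis:
  assumes "circ_H1 F"
  shows "circ_H1 (\<lambda>t. F t * cis t)"
proof -
  have "integrable circ_meas (\<lambda>t. F t * cis t)"
    using integrable_mult_cis[OF circ_H1_integrable[OF assms], of 1] by simp
  moreover have "(LINT t|circ_meas. F t * cis t * cis (of_nat m * t)) = 0" for m
    using circ_H1_integral[OF assms, of "Suc m"] by (simp add: ring_distribs cis_mult[symmetric] mult.assoc)
  ultimately show ?thesis by (simp add: circ_H1_def)
qed

lemma circ_H1_diff:
  assumes "circ_H1 F" "circ_H1 G"
  shows "circ_H1 (\<lambda>t. F t - G t)"
  using assms by (auto simp: circ_H1_def left_diff_distrib)

lemma circ_H1_const: "circ_H1 (\<lambda>_. c)"
proof -
  have "(LINT t|circ_meas. c * cis (of_nat m * t)) = 0" if "0 < m" for m :: nat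
    using integral_cis[of "int m"] that by simp
  then show ?thesis by (simp add: circ_H1_def)
qed

lemma circ_H1_cong_AE:
  assumes "circ_H1 F" "G \<in> borel_measurable circ_meas" "AE t in circ_meas. F t = G t"
  shows "circ_H1 G"
proof -
  have [measurable]: "F \<in> borel_measurable circ_meas" "G \<in> borel_measurable circ_meas"
    using assms circ_H1_integrable by auto
  have "integrable circ_meas G"
    using assms(2,3) circ_H1_integrable[OF assms(1)] by (rule integrable_cong_AE_imp[rotated])
  moreover have "(LINT t|circ_meas. G t * cis (of_nat m * t)) = (LINT t|circ_meas. F t * cis (of_nat m * t))" for m
    using assms(3) by (intro integral_cong_AE) auto
  ultimately show ?thesis using assms(1) by (simp add: circ_H1_def)
qed

section \<open>Testing against analytic polynomials and their exponentials\<close>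

lemma poly_cis_bounded: "\<exists>C. \<forall>t. norm (poly q (cis t)) \<le> C"
proof -
  have "bounded (poly q ` sphere 0 1)"
    by (intro compact_imp_bounded compact_continuous_image continuous_intros) auto
  then obtain C where "\<forall>z\<in>sphere 0 1. norm (poly q z) \<le> C" by (auto simp: bounded_iff)
  then have "\<forall>t. norm (poly q (cis t)) \<le> C" by simp
  then show ?thesis by blast
qed

lemma poly_cis_measurable [measurable]: "(\<lambda>t. poly q (cis t)) \<in> borel_measurable circ_meas"
  by (intro continuous_measurable_circ continuous_intros)

lemma integrable_mult_poly_cis:
  assumes "integrable circ_meas F"
  shows "integrable circ_meas (\<lambda>t. F t * poly q (cis t))"
proof -
  obtain C where "\<forall>t. norm (poly q (cis t)) \<le> C" using poly_cis_bounded by blast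
  then show ?thesis by (intro integrable_mult_bounded[of _ _ C] assms) auto
qed

text \<open>Horner's scheme: in \<open>a + z * q z\<close> the second summand moves its factor
  \<open>z\<close> to \<open>F\<close>, and the mean of \<open>F t * cis t\<close> is zero. This
  changes \<open>F\<close>, so the induction keeps it arbitrary.\<close>

lemma circ_H1_integral_poly:
  assumes "circ_H1 F"
  shows "(LINT t|circ_meas. F t * poly q (cis t)) = poly q 0 * (LINT t|circ_meas. F t)"
  using assms
proof (induction q arbitrary: F)
  case 0
  then show ?case by simp
next
  case (pCons a q)
  have "(LINT t|circ_meas. F t * poly (pCons a q) (cis t))
      = (LINT t|circ_meas. F t * a + F t * cis t * poly q (cis t))"
    by (simp add: algebra_simps)
  also have "\<dots> = (LINT t|circ_meas. F t * a) + (LINT t|circ_meas. F t * cis t * poly q (cis t))"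
    using circ_H1_integrable[OF pCons.prems] circ_H1_integrable[OF circ_H1_cis[OF pCons.prems]]
    by (intro Bochner_Integration.integral_add integrable_mult_poly_cis) auto
  also have "(LINT t|circ_meas. F t * cis t * poly q (cis t)) = 0"
    using pCons.IH[OF circ_H1_cis[OF pCons.prems]] circ_H1_integral[OF pCons.prems, of 1] by simp
  finally show ?case by (simp add: mult.commute)
qed

text \<open>The Taylor sums of \<open>exp\<close> at \<open>q\<close> are again polynomials, bounded
  on the circle by \<open>exp C\<close>, so dominated convergence carries the polynomial case
  over.\<close>

lemma circ_H1_integral_exp:
  assumes F: "circ_H1 F"
  shows "(LINT t|circ_meas. F t * exp (poly q (cis t))) = exp (poly q 0) * (LINT t|circ_meas. F t)"
proof -
  have [measurable]: "F \<in> borel_measurable circ_meas" using circ_H1_integrable[OF F] by auto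
  define r where "r n = (\<Sum>i<n. smult (1 / fact i) (q ^ i))" for n :: nat
  have r: "poly (r n) z = (\<Sum>i<n. (poly q z)^i /\<^sub>R fact i)" for n z
    by (simp add: r_def poly_sum scaleR_conv_of_real divide_inverse)
  have rlim: "(\<lambda>n. poly (r n) z) \<longlonglongrightarrow> exp (poly q z)" for z
    using exp_converges[of "poly q z"] unfolding r sums_def .
  obtain C where C: "\<forall>t. norm (poly q (cis t)) \<le> C" using poly_cis_bounded by blast
  have rbd: "norm (poly (r n) (cis t)) \<le> exp C" for n t
  proof -
    let ?w = "poly q (cis t)"
    have "norm (poly (r n) (cis t)) \<le> (\<Sum>i<n. norm (?w^i /\<^sub>R fact i))" unfolding r by (rule norm_sum)
    also have "\<dots> = (\<Sum>i<n. (norm ?w)^i /\<^sub>R fact i)" by (simp add: norm_power)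
    also have "\<dots> \<le> (\<Sum>i. (norm ?w)^i /\<^sub>R fact i)"
      by (rule sum_le_suminf) (use summable_exp[of "norm ?w"] in \<open>auto simp: mult.commute\<close>)
    also have "\<dots> = exp (norm ?w)" by (simp add: exp_def)
    also have "\<dots> \<le> exp C" using C by simp
    finally show ?thesis .
  qed
  have "(\<lambda>n. LINT t|circ_meas. F t * poly (r n) (cis t)) \<longlonglongrightarrow> (LINT t|circ_meas. F t * exp (poly q (cis t)))"
  proof (rule integral_dominated_convergence)
    show "integrable circ_meas (\<lambda>t. exp C * norm (F t))" using circ_H1_integrable[OF F] by auto
    show "AE t in circ_meas. (\<lambda>n. F t * poly (r n) (cis t)) \<longlonglongrightarrow> F t * exp (poly q (cis t))"
      by (intro AE_I2 tendsto_intros rlim)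
    show "AE t in circ_meas. norm (F t * poly (r n) (cis t)) \<le> exp C * norm (F t)" for n
      using rbd[of n] by (auto simp: norm_mult mult.commute[of "exp C"] intro!: AE_I2 mult_left_mono)
    show "(\<lambda>t. F t * exp (poly q (cis t))) \<in> borel_measurable circ_meas"
      by measurable
  qed measurable
  moreover have "(\<lambda>n. LINT t|circ_meas. F t * poly (r n) (cis t)) \<longlonglongrightarrow> exp (poly q 0) * (LINT t|circ_meas. F t)"
    unfolding circ_H1_integral_poly[OF F] by (intro tendsto_intros rlim)
  ultimately show ?thesis by (rule LIMSEQ_unique)
qed

text \<open>Conjugation preserves the real part and turns a negative frequency into a positive
  one.\<close>

lemma trig_poly_Re_poly:
  "trig_poly p \<Longrightarrow> \<exists>q. \<forall>t. Re (p t) = Re (poly q (cis t))"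
proof (induction rule: trig_poly.induct)
  case (monom c n)
  show ?case
  proof (cases "n \<ge> 0")
    case True
    then have "\<forall>t. c * cis (of_int n * t) = poly (Polynomial.monom c (nat n)) (cis t)"
      by (simp add: poly_monom Complex.DeMoivre)
    then show ?thesis by metis
  next
    case False
    then have "\<forall>t. cnj (c * cis (of_int n * t)) = poly (Polynomial.monom (cnj c) (nat (-n))) (cis t)"
      by (simp add: poly_monom Complex.DeMoivre cis_cnj)
    then show ?thesis by (metis cnj.simps(1))
  qed
next
  case (add p q)
  then obtain a b where "\<forall>t. Re (p t) = Re (poly a (cis t))" "\<forall>t. Re (q t) = Re (poly b (cis t))" by auto
  then have "\<forall>t. Re (p t + q t) = Re (poly (a + b) (cis t))" by simp
  then show ?case by blast
qed

text \<open>Since \<open>exp q\<close> is analytic, the mean of \<open>F exp q\<close> is the product of the means.\<close>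

lemma circ_H1_jensen:
  assumes F: "circ_H1 F" and p: "trig_poly p"
  shows "norm (LINT t|circ_meas. F t) * exp ((LINT t|circ_meas. Re (p t)) / (2 * pi))
    \<le> (LINT t|circ_meas. norm (F t) * exp (Re (p t)))"
proof -
  obtain q where q: "\<And>t. Re (p t) = Re (poly q (cis t))" using trig_poly_Re_poly[OF p] by blast
  have "integrable circ_meas (\<lambda>t. poly q (cis t))"
    using integrable_mult_poly_cis[of "\<lambda>_. 1" q] by simp
  moreover have "(LINT t|circ_meas. poly q (cis t)) = poly q 0 * (2 * pi)"
    using circ_H1_integral_poly[OF circ_H1_const[of 1], of q]
    by (simp add: measure_circ_meas scaleR_conv_of_real)
  ultimately have mean: "(LINT t|circ_meas. Re (p t)) = Re (poly q 0) * (2 * pi)"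
    unfolding q by (simp add: integral_Re)
  have "norm (LINT t|circ_meas. F t) * exp ((LINT t|circ_meas. Re (p t)) / (2 * pi))
      = norm (exp (poly q 0) * (LINT t|circ_meas. F t))"
    unfolding mean by (simp add: norm_mult)
  also have "\<dots> = norm (LINT t|circ_meas. F t * exp (poly q (cis t)))"
    by (simp only: circ_H1_integral_exp[OF F])
  also have "\<dots> \<le> (LINT t|circ_meas. norm (F t * exp (poly q (cis t))))"
    by (rule integral_norm_bound)
  finally show ?thesis by (simp add: norm_mult q)
qed

text \<open>The weight \<open>exp (M * indicator E t)\<close> is 1 off \<open>E\<close>, and
  \<open>F\<close> vanishes on \<open>E\<close>. So the upper bound in \<open>circ_H1_jensen\<close>
  does not grow with \<open>M\<close>, whereas the lower one grows exponentially unless the mean is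
  zero.\<close>

lemma circ_H1_mean_zero:
  assumes F: "circ_H1 F" and A: "A \<in> sets circ_meas" "0 < measure circ_meas A"
    and zero: "AE t in circ_meas. t \<in> A \<longrightarrow> F t = 0"
  shows "(LINT t|circ_meas. F t) = 0"
proof (rule ccontr)
  assume "(LINT t|circ_meas. F t) \<noteq> 0"
  then have c: "norm (LINT t|circ_meas. F t) > 0" (is "?c > 0") by simp
  have int: "integrable circ_meas F" using F by (rule circ_H1_integrable)
  then have [measurable]: "F \<in> borel_measurable circ_meas" by auto
  obtain E where E: "compact E" "E \<subseteq> A" "E \<subseteq> {0<..<2*pi}" "E \<in> sets circ_meas"
    "measure circ_meas (A - E) < measure circ_meas A"
    using circ_inner_compact[OF A] by metis
  note [measurable] = E(4)
  have mE: "measure circ_meas E > 0"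
    using circ.finite_measure_Diff[OF A(1) E(4,2)] E(5) by simp
  obtain p where p: "\<And>k::nat. trig_poly (p k)" "\<And>k t. norm (p k t) \<le> 2"
    "\<And>t. t \<in> {0<..<2*pi} \<Longrightarrow> (\<lambda>k. p k t) \<longlonglongrightarrow> of_real (indicator E t)"
    using trig_poly_approx_indicator[OF E(1,3)] by metis
  note [measurable] = trig_poly_measurable[OF p(1)]
  \<comment> \<open>For fixed \<open>M\<close>, \<open>circ_H1_jensen\<close> at
    \<open>of_nat M * p k\<close> is passed to the limit in \<open>k\<close> on both sides.\<close>
  have bound: "?c * exp (real M * measure circ_meas E / (2 * pi)) \<le> (LINT t|circ_meas. norm (F t))" for M :: nat
  proof (rule LIMSEQ_le)
    show "\<exists>N. \<forall>k\<ge>N. ?c * exp ((LINT t|circ_meas. Re (of_nat M * p k t)) / (2 * pi))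
        \<le> (LINT t|circ_meas. norm (F t) * exp (Re (of_nat M * p k t)))"
      using circ_H1_jensen[OF F trig_poly_cmult[OF p(1)]] by blast
    have "(\<lambda>k. LINT t|circ_meas. of_nat M * p k t) \<longlonglongrightarrow> (LINT t|circ_meas. of_nat M * complex_of_real (indicator E t))"
      by (intro integral_mult_trig_poly_tendsto[where C=2]) (use p E in auto)
    then have "(\<lambda>k. Re (LINT t|circ_meas. of_nat M * p k t)) \<longlonglongrightarrow> Re (LINT t|circ_meas. of_nat M * complex_of_real (indicator E t))"
      by (rule tendsto_Re)
    moreover have "E \<inter> {0..2*pi} = E" using E(3) by auto
    then have "Re (LINT t|circ_meas. of_nat M * complex_of_real (indicator E t)) = real M * measure circ_meas E"
      by simp
    moreover have "Re (LINT t|circ_meas. of_nat M * p k t) = (LINT t|circ_meas. Re (of_nat M * p k t))" for k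
      using trig_poly_integrable[OF trig_poly_cmult[OF p(1)]] by (simp only: integral_Re)
    ultimately have "(\<lambda>k. LINT t|circ_meas. Re (of_nat M * p k t)) \<longlonglongrightarrow> real M * measure circ_meas E"
      by (simp only:)
    then show "(\<lambda>k. ?c * exp ((LINT t|circ_meas. Re (of_nat M * p k t)) / (2 * pi)))
        \<longlonglongrightarrow> ?c * exp (real M * measure circ_meas E / (2 * pi))"
      by (intro tendsto_intros) auto
    have "(\<lambda>k. LINT t|circ_meas. norm (F t) * exp (Re (of_nat M * p k t)))
        \<longlonglongrightarrow> (LINT t|circ_meas. norm (F t) * exp (Re (of_nat M * of_real (indicator E t))))"
    proof (rule integral_dominated_convergence)
      show "integrable circ_meas (\<lambda>t. exp (real M * 2) * norm (F t))" using int by auto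
      show "AE t in circ_meas. (\<lambda>k. norm (F t) * exp (Re (of_nat M * p k t)))
         \<longlonglongrightarrow> norm (F t) * exp (Re (of_nat M * of_real (indicator E t)))"
        using AE_circ_interior by eventually_elim (intro tendsto_intros p)
      show "AE t in circ_meas. norm (norm (F t) * exp (Re (of_nat M * p k t))) \<le> exp (real M * 2) * norm (F t)" for k
      proof (rule AE_I2)
        fix t
        have "Re (p k t) \<le> 2" using p(2)[of k t] complex_Re_le_cmod[of "p k t"] by linarith
        then have "Re (of_nat M * p k t) \<le> real M * 2" by (simp add: mult_left_mono)
        then show "norm (norm (F t) * exp (Re (of_nat M * p k t))) \<le> exp (real M * 2) * norm (F t)"
          by (simp add: abs_mult mult.commute[of _ "norm (F t)"] mult_left_mono)
      qed
    qed measurable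
    moreover have "(LINT t|circ_meas. norm (F t) * exp (Re (of_nat M * of_real (indicator E t)))) = (LINT t|circ_meas. norm (F t))"
    proof (rule integral_cong_AE)
      show "AE t in circ_meas. norm (F t) * exp (Re (of_nat M * of_real (indicator E t))) = norm (F t)"
        using zero by eventually_elim (use E(2) in \<open>auto simp: indicator_def\<close>)
    qed measurable
    ultimately show "(\<lambda>k. LINT t|circ_meas. norm (F t) * exp (Re (of_nat M * p k t))) \<longlonglongrightarrow> (LINT t|circ_meas. norm (F t))"
      by simp
  qed
  \<comment> \<open>By \<open>exp x \<ge> 1 + x\<close> the left side of \<open>bound\<close> is at
    least \<open>M * d\<close>, which is unbounded in \<open>M\<close>.\<close>
  define d where "d = ?c * (measure circ_meas E / (2*pi))"
  have "d > 0" using c mE by (simp add: d_def)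
  then obtain M where "(LINT t|circ_meas. norm (F t)) < real M * d"
    using reals_Archimedean3 by blast
  also have "\<dots> = ?c * (real M * measure circ_meas E / (2*pi))" by (simp add: d_def)
  also have "\<dots> \<le> ?c * exp (real M * measure circ_meas E / (2*pi))"
    using c exp_ge_add_one_self[of "real M * measure circ_meas E / (2*pi)"]
    by (intro mult_left_mono) linarith+
  also have "\<dots> \<le> (LINT t|circ_meas. norm (F t))" by (rule bound)
  finally show False by simp
qed

text \<open>Once the mean vanishes, one may divide by the coordinate function and iterate.\<close>

lemma circ_H1_unique:
  assumes F: "circ_H1 F" and A: "A \<in> sets circ_meas" "0 < measure circ_meas A"
    and zero: "AE t in circ_meas. t \<in> A \<longrightarrow> F t = 0"
  shows "AE t in circ_meas. F t = 0"
proof -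
  have shift: "circ_H1 (\<lambda>t. F t * cis (- (of_nat n * t)))"
    "(LINT t|circ_meas. F t * cis (- (of_nat n * t))) = 0" for n
  proof -
    have mean: "(LINT t|circ_meas. F t * cis (- (of_nat n * t))) = 0"
      if "circ_H1 (\<lambda>t. F t * cis (- (of_nat n * t)))" for n
      using that A by (rule circ_H1_mean_zero) (use zero in auto)
    show H: "circ_H1 (\<lambda>t. F t * cis (- (of_nat n * t)))"
    proof (induction n)
      case 0
      then show ?case using F by simp
    next
      case (Suc n)
      have "(LINT t|circ_meas. F t * cis (- (of_nat (Suc n) * t)) * cis (of_nat m * t)) = 0" if m: "0 < m" for m
      proof -
        \<comment> \<open>Condition \<open>m\<close> after one more division by \<open>z\<close> is
          condition \<open>m - 1\<close> before it; for \<open>m = 1\<close> that is the vanishing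
          of the mean.\<close>
        obtain l where l: "m = Suc l" using m by (cases m) auto
        have "F t * cis (- (of_nat (Suc n) * t)) * cis (of_nat m * t) = F t * cis (- (of_nat n * t)) * cis (of_nat l * t)" for t
          by (simp add: l mult.assoc cis_mult algebra_simps)
        moreover have "(LINT t|circ_meas. F t * cis (- (of_nat n * t)) * cis (of_nat l * t)) = 0"
          using circ_H1_integral[OF Suc.IH, of l] mean[OF Suc.IH] by (cases "l = 0") auto
        ultimately show ?thesis by (simp only:)
      qed
      moreover have "integrable circ_meas (\<lambda>t. F t * cis (- (of_nat (Suc n) * t)))"
        using integrable_mult_cis[OF circ_H1_integrable[OF F], of "- of_nat (Suc n)"]
        by (simp only: minus_mult_left)
      ultimately show ?case by (simp add: circ_H1_def)
    qed
    show "(LINT t|circ_meas. F t * cis (- (of_nat n * t))) = 0" by (rule mean[OF H])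
  qed
  have "(LINT t|circ_meas. F t * cis (of_int n * t)) = 0" for n :: int
  proof (cases "n > 0")
    case True
    then show ?thesis using circ_H1_integral[OF F, of "nat n"] by simp
  next
    case False
    then show ?thesis using shift(2)[of "nat (-n)"] by simp
  qed
  then show ?thesis by (rule fourier_unique[OF circ_H1_integrable[OF F]])
qed

section \<open>Fejer means and products\<close>

text \<open>Replacing \<open>G\<close> by a trigonometric polynomial close to it in the mean costs
  at most \<open>2 * C\<close> times their distance, uniformly in \<open>N\<close>; for the
  polynomial the limit holds by linearity.\<close>

lemma bounded_weak_limit:
  fixes G k :: "real \<Rightarrow> complex" and T :: "nat \<Rightarrow> real \<Rightarrow> complex"
  assumes G: "integrable circ_meas G"
    and T [measurable]: "\<And>N. T N \<in> borel_measurable circ_meas"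
    and k [measurable]: "k \<in> borel_measurable circ_meas"
    and Tb: "\<And>N. AE t in circ_meas. norm (T N t) \<le> C" and kb: "AE t in circ_meas. norm (k t) \<le> C"
    and lim: "\<And>n::int. (\<lambda>N. LINT t|circ_meas. cis (of_int n * t) * T N t)
       \<longlonglongrightarrow> (LINT t|circ_meas. cis (of_int n * t) * k t)"
    and C: "0 < C"
  shows "(\<lambda>N. LINT t|circ_meas. G t * T N t) \<longlonglongrightarrow> (LINT t|circ_meas. G t * k t)"
proof -
  have iT: "integrable circ_meas (\<lambda>t. F t * T N t)" and ik: "integrable circ_meas (\<lambda>t. F t * k t)"
    if "integrable circ_meas F" for F N
    using that by (auto intro!: integrable_mult_bounded Tb kb)
  have tp: "(\<lambda>N. LINT t|circ_meas. p t * T N t) \<longlonglongrightarrow> (LINT t|circ_meas. p t * k t)" if "trig_poly p" for p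
    using that
  proof (induction rule: trig_poly.induct)
    case (monom c n)
    then show ?case using tendsto_mult_left[OF lim[of n], of c] by (simp add: mult.assoc)
  next
    case (add p q)
    then show ?case
      using tendsto_add[OF add.IH] iT ik trig_poly_integrable by (simp add: ring_distribs)
  qed
  show ?thesis
  proof (rule LIMSEQ_I)
    fix e :: real assume e: "0 < e"
    \<comment> \<open>Chosen so that the error \<open>2 * C * d\<close> is half of
      \<open>e\<close>.\<close>
    define d where "d = e / (4 * C)"
    have d: "0 < d" using e C by (simp add: d_def)
    obtain p where p: "trig_poly p" "(LINT t|circ_meas. norm (G t - p t)) < d"
      using trig_poly_dense[OF G d] by blast
    note ip = trig_poly_integrable[OF p(1)]
    obtain N0 where N0: "\<And>N. N \<ge> N0 \<Longrightarrow>
        norm ((LINT t|circ_meas. p t * T N t) - (LINT t|circ_meas. p t * k t)) < e / 2"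
      using LIMSEQ_D[OF tp[OF p(1)], of "e/2"] e by auto
    have "norm ((LINT t|circ_meas. G t * T N t) - (LINT t|circ_meas. G t * k t)) < e" if "N \<ge> N0" for N
    proof -
      have iGp: "integrable circ_meas (\<lambda>t. G t - p t)" using G ip by auto
      have iD: "integrable circ_meas (\<lambda>t. (G t - p t) * (T N t - k t))"
        using iT[OF iGp, of N] ik[OF iGp] by (simp add: right_diff_distrib)
      have "(LINT t|circ_meas. G t * T N t) - (LINT t|circ_meas. G t * k t)
          = (LINT t|circ_meas. (G t - p t) * (T N t - k t))
            + ((LINT t|circ_meas. p t * T N t) - (LINT t|circ_meas. p t * k t))"
        using iT[OF G, of N] ik[OF G] iT[OF ip, of N] ik[OF ip]
        by (simp add: right_diff_distrib left_diff_distrib)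
      then have "norm ((LINT t|circ_meas. G t * T N t) - (LINT t|circ_meas. G t * k t))
          \<le> norm (LINT t|circ_meas. (G t - p t) * (T N t - k t))
            + norm ((LINT t|circ_meas. p t * T N t) - (LINT t|circ_meas. p t * k t))"
        by (simp add: norm_triangle_ineq)
      also have "norm (LINT t|circ_meas. (G t - p t) * (T N t - k t))
          \<le> (LINT t|circ_meas. norm ((G t - p t) * (T N t - k t)))"
        by (rule integral_norm_bound)
      also have "\<dots> \<le> (LINT t|circ_meas. (2 * C) * norm (G t - p t))"
      proof (rule integral_mono_AE)
        show "AE t in circ_meas. norm ((G t - p t) * (T N t - k t)) \<le> (2 * C) * norm (G t - p t)"
          using Tb[of N] kb
        proof eventually_elim
          case (elim t)
          then have "norm (T N t - k t) \<le> 2 * C" using norm_triangle_ineq4[of "T N t" "k t"] by linarith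
          then have "norm (G t - p t) * norm (T N t - k t) \<le> norm (G t - p t) * (2 * C)"
            by (intro mult_left_mono) auto
          then show ?case by (simp add: norm_mult mult.commute)
        qed
      qed (use iD iGp in auto)
      also have "\<dots> < (2 * C) * d" using p(2) C by simp
      also have "\<dots> = e / 2" using C by (simp add: d_def)
      finally show ?thesis using N0[OF that] by linarith
    qed
    then show "\<exists>N0. \<forall>N\<ge>N0. norm ((LINT t|circ_meas. G t * T N t) - (LINT t|circ_meas. G t * k t)) < e"
      by blast
  qed
qed

text \<open>The double sum exhibits the Fejer mean as an average of \<open>k\<close> against the nonnegative kernel
  \<open>\<bar>\<Sum>j<N. cis (j (x - t))\<bar>\<^sup>2 / (2 \<pi> N)\<close>, which makes the bound by \<open>sup \<bar>k\<bar>\<close> evident.\<close>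

definition fejer_mean :: "(real \<Rightarrow> complex) \<Rightarrow> nat \<Rightarrow> real \<Rightarrow> complex" where
  "fejer_mean k N x = (\<Sum>j<N. \<Sum>l<N. cis ((real j - real l) * x) *
      (LINT t|circ_meas. k t * cis ((real l - real j) * t))) / (2 * pi * N)"

lemma fejer_mean_continuous: "continuous_on UNIV (fejer_mean k N)"
  unfolding fejer_mean_def divide_inverse by (intro continuous_intros)

lemma fejer_kernel:
  "complex_of_real ((norm (\<Sum>j<N. cis (real j * y)))\<^sup>2) = (\<Sum>j<N. \<Sum>l<N. cis ((real j - real l) * y))"
  unfolding complex_norm_square
  by (simp add: cnj_sum sum_product cis_cnj cis_mult left_diff_distrib)

text \<open>Orthogonality leaves the \<open>N\<close> diagonal terms, each contributing
  \<open>2 * pi\<close>. This explains the normalisation in \<open>fejer_mean\<close>.\<close>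

lemma integral_fejer_kernel:
  "(LINT t|circ_meas. (norm (\<Sum>j<N. cis (real j * (x - t))))\<^sup>2) = 2 * pi * N"
proof -
  have eq: "cis ((real j - real l) * (x - t)) = cis ((real j - real l) * x) * cis (of_int (int l - int j) * t)" for j l t
    by (simp add: cis_mult algebra_simps)
  have "complex_of_real (LINT t|circ_meas. (norm (\<Sum>j<N. cis (real j * (x - t))))\<^sup>2)
      = (LINT t|circ_meas. complex_of_real ((norm (\<Sum>j<N. cis (real j * (x - t))))\<^sup>2))"
    by (rule integral_complex_of_real[symmetric])
  also have "\<dots> = (\<Sum>j<N. \<Sum>l<N. cis ((real j - real l) * x) * (LINT t|circ_meas. cis (of_int (int l - int j) * t)))"
    unfolding fejer_kernel eq
    by (subst Bochner_Integration.integral_sum, force)+ simp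
  also have "\<dots> = (\<Sum>j<N. \<Sum>l<N. if l = j then 2 * of_real pi else 0)"
    unfolding integral_cis by (intro sum.cong refl) auto
  also have "\<dots> = complex_of_real (2 * pi * N)" by simp
  finally show ?thesis by (simp only: of_real_eq_iff)
qed

lemma fejer_mean_bounded:
  assumes k [measurable]: "k \<in> borel_measurable circ_meas" and b: "AE t in circ_meas. norm (k t) \<le> C"
    and C: "0 \<le> C"
  shows "norm (fejer_mean k N x) \<le> C"
proof (cases "N = 0")
  \<comment> \<open>The sums are empty, so the mean is 0 despite the division by
    \<open>N\<close>.\<close>
  case True
  then show ?thesis using C by (simp add: fejer_mean_def)
next
  case False
  have ik: "integrable circ_meas k" using b by (rule circ.integrable_const_bound) measurable
  define D where "D t = (norm (\<Sum>j<N. cis (real j * (x - t))))\<^sup>2" for t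
  have "continuous_on UNIV D" unfolding D_def by (intro continuous_intros)
  then have [measurable]: "D \<in> borel_measurable circ_meas" by (rule continuous_measurable_circ)
  have D0: "0 \<le> D t" for t by (simp add: D_def)
  have "D t \<le> (real N)\<^sup>2" for t
    unfolding D_def
    by (intro power_mono order_trans[OF norm_sum]) auto
  then have iD: "integrable circ_meas D"
    by (intro circ.integrable_const_bound[of _ "(real N)\<^sup>2"]) (auto simp: D0)
  have eq: "cis ((real j - real l) * (x - t)) = cis ((real j - real l) * x) * cis ((real l - real j) * t)" for j l t
    by (simp add: cis_mult algebra_simps)
  have "k t * of_real (D t) = (\<Sum>j<N. \<Sum>l<N. cis ((real j - real l) * x) * (k t * cis ((real l - real j) * t)))" for t
    unfolding D_def fejer_kernel eq by (simp add: sum_distrib_left mult.left_commute)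
  then have kD: "(\<lambda>t. k t * of_real (D t)) =
      (\<lambda>t. \<Sum>j<N. \<Sum>l<N. cis ((real j - real l) * x) * (k t * cis ((real l - real j) * t)))" by blast
  have ikD: "integrable circ_meas (\<lambda>t. k t * of_real (D t))"
    unfolding kD using ik by (intro Bochner_Integration.integrable_sum integrable_mult_right integrable_mult_cis)
  have "(LINT t|circ_meas. k t * of_real (D t)) = (\<Sum>j<N. \<Sum>l<N. cis ((real j - real l) * x) *
      (LINT t|circ_meas. k t * cis ((real l - real j) * t)))"
    unfolding kD using ik
    by (subst Bochner_Integration.integral_sum, force)+ simp
  then have "norm (fejer_mean k N x) = norm (LINT t|circ_meas. k t * of_real (D t)) / (2 * pi * N)"
    by (simp add: fejer_mean_def norm_divide norm_mult)
  also have "\<dots> \<le> (LINT t|circ_meas. norm (k t * of_real (D t))) / (2 * pi * N)"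
    by (intro divide_right_mono integral_norm_bound) auto
  also have "\<dots> \<le> (LINT t|circ_meas. C * D t) / (2 * pi * N)"
  proof (intro divide_right_mono integral_mono_AE)
    show "AE t in circ_meas. norm (k t * of_real (D t)) \<le> C * D t"
      using b by eventually_elim (auto simp: norm_mult D0 intro!: mult_right_mono)
  qed (use ikD iD in auto)
  also have "\<dots> = C"
    using integral_fejer_kernel[of x N] False by (simp add: D_def)
  finally show ?thesis .
qed

text \<open>The mean multiplies each Fourier coefficient by the Fejer damping factor, which is at
  least \<open>1 - \<bar>n\<bar> / N\<close> and at most 1.\<close>

lemma fejer_mean_fourier_limit:
  fixes n :: int
  shows "(\<lambda>N. LINT t|circ_meas. cis (of_int n * t) * fejer_mean k N t)
       \<longlonglongrightarrow> (LINT t|circ_meas. cis (of_int n * t) * k t)"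
proof -
  define a where "a = (LINT t|circ_meas. cis (of_int n * t) * k t)"
  \<comment> \<open>Counts the pairs \<open>(j, l)\<close> of the double sum with
    \<open>l - j = n\<close>, the only ones that survive orthogonality.\<close>
  define m where "m N = card {j. j < N \<and> 0 \<le> int j + n \<and> int j + n < int N}" for N
  have eq: "(LINT t|circ_meas. cis (of_int n * t) * fejer_mean k N t) = a * of_real (m N / N)" for N
  proof -
    let ?b = "\<lambda>(j::nat) (l::nat). (LINT t|circ_meas. k t * cis ((real l - real j) * t))"
    have c: "cis (of_int n * t) * (cis ((real j - real l) * t) * b / (2 * pi * N))
        = b / (2 * pi * N) * cis (of_int (n + int j - int l) * t)" for j l t b
    proof -
      have "cis (of_int (n + int j - int l) * t) = cis (of_int n * t) * cis ((real j - real l) * t)"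
        by (simp add: cis_mult algebra_simps)
      then show ?thesis by (simp only: times_divide_eq_left times_divide_eq_right mult_ac)
    qed
    have "(LINT t|circ_meas. cis (of_int n * t) * fejer_mean k N t)
      = (LINT t|circ_meas. (\<Sum>j<N. \<Sum>l<N. ?b j l / (2 * pi * N) * cis (of_int (n + int j - int l) * t)))"
      unfolding fejer_mean_def sum_divide_distrib sum_distrib_left c ..
    also have "\<dots> = (\<Sum>j<N. \<Sum>l<N. ?b j l / (2 * pi * N) * (LINT t|circ_meas. cis (of_int (n + int j - int l) * t)))"
      by (subst Bochner_Integration.integral_sum, force)+ simp
    also have "\<dots> = (\<Sum>j<N. \<Sum>l<N. if n + int j = int l then a / N else 0)"
    proof (intro sum.cong refl)
      fix j l :: nat
      show "?b j l / (2 * pi * N) * (LINT t|circ_meas. cis (of_int (n + int j - int l) * t))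
          = (if n + int j = int l then a / N else 0)"
      proof (cases "n + int j = int l")
        case True
        then have "real l - real j = of_int n" by linarith
        then have "?b j l = a" by (simp add: a_def mult.commute)
        then show ?thesis using True by (simp add: measure_circ_meas scaleR_conv_of_real)
      qed (simp add: integral_cis del: of_int_add of_int_diff)
    qed
    also have "\<dots> = (\<Sum>j<N. if 0 \<le> int j + n \<and> int j + n < int N then a / N else 0)"
    proof (intro sum.cong refl)
      fix j
      have "(\<Sum>l<N. if n + int j = int l then a / N else 0) = (\<Sum>l<N. if 0 \<le> n + int j \<and> l = nat (n + int j) then a / N else 0)"
        by (intro sum.cong refl) auto
      also have "\<dots> = (if 0 \<le> int j + n \<and> int j + n < int N then a / N else 0)"
        by (cases "0 \<le> n + int j") (auto simp: add.commute nat_less_iff)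
      finally show "(\<Sum>l<N. if n + int j = int l then a / N else 0) = \<dots>" .
    qed
    also have "\<dots> = of_nat (m N) * (a / N)"
      by (subst sum.inter_filter[symmetric]) (auto simp: m_def)
    finally show ?thesis by simp
  qed
  have "(\<lambda>N. m N / N) \<longlonglongrightarrow> 1"
  proof (rule tendsto_sandwich)
    have "(\<lambda>N. 1 - \<bar>real_of_int n\<bar> * (1 / real N)) \<longlonglongrightarrow> 1 - \<bar>real_of_int n\<bar> * 0"
      by (intro tendsto_intros lim_1_over_n)
    then show "(\<lambda>N. 1 - \<bar>real_of_int n\<bar> / real N) \<longlonglongrightarrow> 1" by simp
    show "\<forall>\<^sub>F N in sequentially. 1 - \<bar>real_of_int n\<bar> / real N \<le> m N / N"
    proof (rule eventually_mono[OF eventually_gt_at_top[of 0]])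
      fix N :: nat assume N: "0 < N"
      \<comment> \<open>An interval of at least \<open>N - \<bar>n\<bar>\<close> indices that are
        counted by \<open>m N\<close>.\<close>
      have "{nat (-n)..<N - nat n} \<subseteq> {j. j < N \<and> 0 \<le> int j + n \<and> int j + n < int N}" by auto
      then have "card {nat (-n)..<N - nat n} \<le> m N" unfolding m_def by (intro card_mono) auto
      then have "real N - \<bar>of_int n\<bar> \<le> real (m N)" by simp
      then show "1 - \<bar>real_of_int n\<bar> / real N \<le> m N / N"
        using N divide_right_mono[of "real N - \<bar>of_int n\<bar>" "real (m N)" "real N"]
        by (simp add: diff_divide_distrib)
    qed
    show "\<forall>\<^sub>F N in sequentially. m N / N \<le> 1"
    proof (rule always_eventually, rule allI)
      fix N
      have "m N \<le> card {..<N}" unfolding m_def by (intro card_mono) auto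
      then show "m N / N \<le> 1" by (auto simp: divide_le_eq_1)
    qed
  qed auto
  then have "(\<lambda>N. a * of_real (m N / N)) \<longlonglongrightarrow> a * of_real 1" by (intro tendsto_intros)
  then show ?thesis unfolding eq by (simp add: a_def)
qed

text \<open>The Fejer means of \<open>k\<close> are analytic polynomials, for which the claim is a
  finite computation. They obey the bound of \<open>k\<close> and converge weakly to it, which is
  enough against a merely integrable \<open>F\<close>.\<close>

lemma circ_H1_mult_bounded:
  assumes F: "circ_H1 F" and k: "circ_H1 k" and b: "AE t in circ_meas. norm (k t) \<le> C"
  shows "circ_H1 (\<lambda>t. k t * F t)"
proof -
  have iF: "integrable circ_meas F" and ik: "integrable circ_meas k"
    using F k circ_H1_integrable by auto
  have mk [measurable]: "k \<in> borel_measurable circ_meas" using ik by auto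
  \<comment> \<open>\<open>bounded_weak_limit\<close> asks for a strictly positive bound.\<close>
  define C' where "C' = \<bar>C\<bar> + 1"
  have C': "0 < C'" by (simp add: C'_def)
  have b': "AE t in circ_meas. norm (k t) \<le> C'"
    using b by eventually_elim (simp add: C'_def)
  have "(LINT t|circ_meas. k t * F t * cis (of_nat m * t)) = 0" if m: "0 < m" for m :: nat
  proof -
    define G where "G t = F t * cis (of_nat m * t)" for t
    have iG: "integrable circ_meas G"
      using integrable_mult_cis[OF iF, of "of_nat m"] by (simp add: G_def[abs_def])
    have lim: "(\<lambda>N. LINT t|circ_meas. G t * fejer_mean k N t) \<longlonglongrightarrow> (LINT t|circ_meas. G t * k t)"
    proof (rule bounded_weak_limit[OF iG _ mk _ b' _ C'])
      show "fejer_mean k N \<in> borel_measurable circ_meas" for N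
        by (intro continuous_measurable_circ fejer_mean_continuous)
      show "AE t in circ_meas. norm (fejer_mean k N t) \<le> C'" for N
        using fejer_mean_bounded[OF mk b'] C' by simp
    qed (rule fejer_mean_fourier_limit)
    have "(LINT t|circ_meas. G t * fejer_mean k N t) = 0" for N
    proof -
      let ?b = "\<lambda>(j::nat) (l::nat). (LINT t|circ_meas. k t * cis ((real l - real j) * t))"
      have "(LINT t|circ_meas. G t * fejer_mean k N t)
        = (LINT t|circ_meas. (\<Sum>j<N. \<Sum>l<N. ?b j l / (2 * pi * N) * (G t * cis ((real j - real l) * t))))"
        unfolding fejer_mean_def sum_divide_distrib sum_distrib_left
        by (simp only: times_divide_eq_left times_divide_eq_right mult_ac)
      also have "\<dots> = (\<Sum>j<N. \<Sum>l<N. ?b j l / (2 * pi * N) * (LINT t|circ_meas. G t * cis ((real j - real l) * t)))"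
        using iG by (subst Bochner_Integration.integral_sum, force)+ simp
      also have "\<dots> = 0"
      proof (intro sum.neutral ballI)
        fix j l :: nat
        show "?b j l / (2 * pi * N) * (LINT t|circ_meas. G t * cis ((real j - real l) * t)) = 0"
        \<comment> \<open>For \<open>j < l\<close> the coefficient of \<open>k\<close> has negative
          index and is zero; otherwise the total frequency \<open>m + (j - l)\<close> is positive
          and the integral against \<open>F\<close> vanishes.\<close>
        proof (cases "j < l")
          case True
          then have "?b j l = 0" using circ_H1_integral[OF k, of "l - j"] by (simp add: of_nat_diff)
          then show ?thesis by simp
        next
          case False
          then have "G t * cis ((real j - real l) * t) = F t * cis (of_nat (m + (j - l)) * t)" for t
            by (simp add: G_def mult.assoc cis_mult of_nat_diff algebra_simps)
          then show ?thesis using circ_H1_integral[OF F, of "m + (j - l)"] m by simp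
        qed
      qed
      finally show ?thesis .
    qed
    then have "(LINT t|circ_meas. G t * k t) = 0" using lim by (simp add: LIMSEQ_const_iff)
    then show ?thesis by (simp add: G_def mult_ac)
  qed
  moreover have "integrable circ_meas (\<lambda>t. k t * F t)"
    using integrable_mult_bounded[OF iF mk b'] by (simp add: mult.commute)
  ultimately show ?thesis by (simp add: circ_H1_def)
qed

section \<open>The symbol\<close>

text \<open>Rests on the completeness of Lebesgue measure. It serves \<open>mult_range\<close>,
  which prescribes its members only almost everywhere.\<close>

lemma circ_measurable_AE:
  fixes F G :: "real \<Rightarrow> complex"
  assumes "G \<in> borel_measurable circ_meas" "AE t in circ_meas. F t = G t"
  shows "F \<in> borel_measurable circ_meas"
proof -
  have "AE t in lebesgue. t \<in> {0..2*pi} \<longrightarrow> F t = G t"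
    using assms(2) by (subst (asm) AE_restrict_space_iff) auto
  then have ae: "AE t in lebesgue. indicator {0..2*pi} t *\<^sub>R G t = indicator {0..2*pi} t *\<^sub>R F t"
    by eventually_elim (auto simp: indicator_def)
  have "(\<lambda>t. indicator {0..2*pi} t *\<^sub>R G t) \<in> borel_measurable lebesgue"
    using assms(1) by (subst (asm) borel_measurable_restrict_space_iff) auto
  from borel_measurable_AE[OF this ae]
  have "(\<lambda>t. indicator {0..2*pi} t *\<^sub>R F t) \<in> borel_measurable lebesgue" .
  then show ?thesis by (subst borel_measurable_restrict_space_iff) auto
qed

section \<open>Translation of the Hardy spaces into \<open>circ_H1\<close>\<close>

lemma fourier_coeff_neg_iff:
  "(\<forall>n::int. n < 0 \<longrightarrow> fourier_coeff f n = 0) \<longleftrightarrow>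
   (\<forall>m::nat. 0 < m \<longrightarrow> (LINT t|circ_meas. f (cis t) * cis (of_nat m * t)) = 0)" (is "?L \<longleftrightarrow> ?R")
proof
  assume L: ?L
  show ?R
  proof (intro allI impI)
    fix m :: nat assume "0 < m"
    then have "fourier_coeff f (- int m) = 0" using L by simp
    then show "(LINT t|circ_meas. f (cis t) * cis (of_nat m * t)) = 0" by (simp add: fourier_coeff_def)
  qed
next
  assume R: ?R
  show ?L
  proof (intro allI impI)
    fix n :: int assume "n < 0"
    then show "fourier_coeff f n = 0" using R[rule_format, of "nat (-n)"] by (simp add: fourier_coeff_def)
  qed
qed

lemma hardy_1_iff: "hardy 1 f \<longleftrightarrow> circ_H1 (\<lambda>t. f (cis t))"
proof -
  have "Lp_circ 1 f \<longleftrightarrow> integrable circ_meas (\<lambda>t. f (cis t))"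
    unfolding Lp_circ_def circ_measurable_def
    using integrable_norm_iff[of "\<lambda>t. f (cis t)" circ_meas] by auto
  then show ?thesis unfolding hardy_def circ_H1_def fourier_coeff_neg_iff by simp
qed

text \<open>On a finite measure space \<open>x \<le> 1 + x\<^sup>2\<close> makes square integrable
  functions integrable.\<close>

lemma hardy_2_iff:
  "hardy 2 f \<longleftrightarrow> circ_H1 (\<lambda>t. f (cis t)) \<and> integrable circ_meas (\<lambda>t. (norm (f (cis t)))\<^sup>2)"
proof -
  have sq: "norm z powr 2 = (norm z)\<^sup>2" for z :: complex
    by (metis norm_ge_zero powr_numeral)
  have L1: "integrable circ_meas F" if [measurable]: "F \<in> borel_measurable circ_meas"
    and i: "integrable circ_meas (\<lambda>t. (norm (F t))\<^sup>2)" for F :: "real \<Rightarrow> complex"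
  proof (rule Bochner_Integration.integrable_bound)
    show "integrable circ_meas (\<lambda>t. 1 + (norm (F t))\<^sup>2)" using i by auto
    have "x \<le> 1 + x\<^sup>2" for x :: real
      using zero_le_power2[of "x - 1/2"] by (simp add: power2_eq_square algebra_simps)
    then show "AE t in circ_meas. norm (F t) \<le> norm (1 + (norm (F t))\<^sup>2)" by simp
  qed measurable
  let ?f = "\<lambda>t. f (cis t)"
  have "?f \<in> borel_measurable circ_meas \<and> integrable circ_meas (\<lambda>t. (norm (?f t))\<^sup>2) \<longleftrightarrow>
      integrable circ_meas ?f \<and> integrable circ_meas (\<lambda>t. (norm (?f t))\<^sup>2)"
    by (intro iffI conjI; elim conjE; (rule L1 borel_measurable_integrable)?; assumption)
  then show ?thesis
    unfolding hardy_def circ_H1_def fourier_coeff_neg_iff Lp_circ_def circ_measurable_def sq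
    by (simp only: conj_ac)
qed

lemma hardy_infD:
  assumes "hardy_inf k"
  shows "circ_H1 (\<lambda>t. k (cis t))" "\<exists>C. AE t in circ_meas. norm (k (cis t)) \<le> C"
proof -
  show b: "\<exists>C. AE t in circ_meas. norm (k (cis t)) \<le> C"
    using assms by (simp add: hardy_inf_def Linf_circ_def)
  moreover have "(\<lambda>t. k (cis t)) \<in> borel_measurable circ_meas"
    using assms by (simp add: hardy_inf_def Linf_circ_def circ_measurable_def)
  ultimately have "integrable circ_meas (\<lambda>t. k (cis t))"
    by (auto intro: circ.integrable_const_bound)
  then show "circ_H1 (\<lambda>t. k (cis t))"
    using assms by (simp add: circ_H1_def hardy_inf_def fourier_coeff_neg_iff)
qed

section \<open>Open sets meeting the circle, and the bands\<close>

lemma circ_open_pos: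
  assumes "open U" "t \<in> U" "t \<in> {0<..<2*pi}"
  shows "U \<inter> {0..2*pi} \<in> sets circ_meas" "0 < measure circ_meas (U \<inter> {0..2*pi})"
proof -
  have U: "U \<in> sets lebesgue" using assms(1) by simp
  show s: "U \<inter> {0..2*pi} \<in> sets circ_meas" using U by (auto simp: sets_restrict_space_iff)
  have "\<not> negligible (U \<inter> {0<..<2*pi})"
    using assms by (intro open_not_negligible) auto
  then have "\<not> negligible (U \<inter> {0..2*pi})" by (rule contrapos_nn) (auto elim: negligible_subset)
  then have "emeasure lebesgue (U \<inter> {0..2*pi}) \<noteq> 0"
    using U by (auto simp: negligible_iff_null_sets null_sets_def simp del: emeasure_completion)
  then have "emeasure circ_meas (U \<inter> {0..2*pi}) \<noteq> 0"
    by (subst emeasure_restrict_space) auto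
  then show "0 < measure circ_meas (U \<inter> {0..2*pi})"
    by (simp add: circ.emeasure_eq_measure zero_less_measure_iff)
qed

text \<open>The preimage of \<open>V\<close> under \<open>cis\<close> is open and contains an
  interior parameter, hence has positive measure in the interval.\<close>

lemma circ_H1_unique_arc:
  assumes F: "circ_H1 F" and V: "open V" "cis s \<in> V" "s \<in> {0<..<2*pi}"
    and zero: "AE t in circ_meas. cis t \<in> V \<longrightarrow> F t = 0"
  shows "AE t in circ_meas. F t = 0"
proof -
  have U: "open (cis -` V)"
    using V(1) by (intro open_vimage continuous_intros)
  show ?thesis
    by (rule circ_H1_unique[OF F circ_open_pos[OF U _ V(3)]]) (use V zero in auto)
qed

text \<open>Vertical strips serving as the sets \<open>B\<^sub>j\<close> of the introduction:
  disjoint, each meeting the circle, and all in the right half-plane, so that the left half of the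
  circle is the free arc.\<close>

definition band :: "nat \<Rightarrow> complex set" where
  "band m = {z. 1 / (real m + 2) < Re z \<and> Re z < 1 / (real m + 1)}"

lemma open_band: "open (band m)"
  unfolding band_def by (intro open_Collect_conj open_Collect_less continuous_intros)

lemma band_Re_pos:
  assumes "z \<in> band m"
  shows "0 < Re z"
proof -
  have "0 < 1 / (real m + 2)" by simp
  also have "\<dots> < Re z" using assms by (simp add: band_def)
  finally show ?thesis .
qed

lemma band_inj:
  assumes "z \<in> band m" "z \<in> band n"
  shows "m = n"
proof -
  have "\<not> m < n" if "z \<in> band m" "z \<in> band n" for m n
  proof
    assume "m < n"
    then have "1 / (real n + 1) \<le> 1 / (real m + 2)" by (intro divide_left_mono) auto
    then show False using that by (auto simp: band_def)
  qed
  then show ?thesis using assms by (meson linorder_neqE_nat)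
qed

lemma band_meets_circle: "\<exists>s\<in>{0<..<2*pi}. cis s \<in> band m"
proof -
  obtain x where x: "1 / (real m + 2) < x" "x < 1 / (real m + 1)"
    using dense[of "1 / (real m + 2)" "1 / (real m + 1)"] by (auto simp: field_simps)
  have "0 < x" using x(1) by (rule less_trans[rotated]) simp
  moreover have "x < 1" using x(2) by (rule less_le_trans) simp
  ultimately have "arccos x \<in> {0<..<2*pi}" "cos (arccos x) = x"
    using arccos_lt_bounded[of x] by auto
  then show ?thesis using x by (intro bexI[of _ "arccos x"]) (auto simp: band_def)
qed

lemma band_measurable [measurable]:
  "(\<lambda>t. indicator (band m) (cis t) :: complex) \<in> borel_measurable circ_meas"
proof -
  have "open (cis -` band m)" by (intro open_vimage open_band continuous_intros)
  then have [measurable]: "cis -` band m \<in> sets lebesgue" by simp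
  have "(\<lambda>t. indicator (band m) (cis t) :: complex) = indicator (cis -` band m)"
    by (auto simp: indicator_def fun_eq_iff)
  moreover have "indicator (cis -` band m) \<in> borel_measurable (lebesgue :: real measure)"
    by measurable
  ultimately show ?thesis by (simp add: measurable_restrict_space1)
qed

text \<open>An entry that vanishes on a set of positive measure vanishes almost everywhere. This
  cannot happen to all entries, since their squared moduli sum to 1.\<close>

lemma inner_column_component_nonzero:
  assumes "inner_column K"
  shows "\<exists>i. AE t in circ_meas. K i (cis t) \<noteq> 0"
proof (rule ccontr)
  assume *: "\<nexists>i. AE t in circ_meas. K i (cis t) \<noteq> 0"
  have "AE t in circ_meas. K i (cis t) = 0" for i
  proof -
    have H: "circ_H1 (\<lambda>t. K i (cis t))" using assms hardy_infD by (auto simp: inner_column_def)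
    then have [measurable]: "(\<lambda>t. K i (cis t)) \<in> borel_measurable circ_meas"
      using circ_H1_integrable borel_measurable_integrable by blast
    define Z where "Z = {t \<in> space circ_meas. K i (cis t) = 0}"
    have Z: "Z \<in> sets circ_meas" unfolding Z_def by measurable
    have "emeasure circ_meas Z \<noteq> 0"
      using * AE_iff_measurable[of Z circ_meas "\<lambda>t. K i (cis t) \<noteq> 0"] Z by (auto simp: Z_def)
    then have "0 < measure circ_meas Z"
      by (simp add: circ.emeasure_eq_measure zero_less_measure_iff)
    then show ?thesis by (intro circ_H1_unique[OF H Z]) (auto simp: Z_def)
  qed
  then have "AE t in circ_meas. \<forall>i. K i (cis t) = 0" by (rule eventually_all_finite)
  moreover have "AE t in circ_meas. (\<Sum>i\<in>UNIV. (cmod (K i (cis t)))\<^sup>2) = 1"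
    using assms by (simp add: inner_column_def)
  ultimately have "AE t in circ_meas. False"
    by eventually_elim simp
  then have "emeasure circ_meas (space circ_meas) = 0"
    by (subst (asm) AE_iff_measurable[of "space circ_meas"]) auto
  then show False using measure_circ_meas by (simp add: measure_def)
qed

text \<open>A row that is a left inverse of \<open>K\<close>: on the band with label \<open>idx j\<close> it tests the
  minor \<open>K i0 * F j - K j * F i0\<close>, and elsewhere it is only division of the \<open>i0\<close>-th entry by \<open>K i0\<close>.\<close>

definition hankel_symbol ::
  "('n::finite \<Rightarrow> nat) \<Rightarrow> 'n \<Rightarrow> ('n \<Rightarrow> complex \<Rightarrow> complex) \<Rightarrow> 'n \<Rightarrow> complex \<Rightarrow> complex" where
  "hankel_symbol idx i0 K i z = (if i = i0 then 1 / K i0 z else 0) +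
     (\<Sum>j\<in>UNIV. indicator (band (idx j)) z *
       ((if i = j then K i0 z else 0) - (if i = i0 then K j z else 0)))"

text \<open>Interchanging the two sums collects the contribution of each band into a minor; for
  \<open>j = i0\<close> this minor is zero.\<close>

lemma hankel_symbol_apply:
  "(\<Sum>i\<in>UNIV. hankel_symbol idx i0 K i z * F i) = F i0 / K i0 z +
     (\<Sum>j\<in>UNIV. indicator (band (idx j)) z * (K i0 z * F j - K j z * F i0))"
proof -
  have "(\<Sum>i\<in>UNIV. hankel_symbol idx i0 K i z * F i) =
      (\<Sum>i\<in>UNIV. (if i = i0 then F i0 / K i0 z else 0)) +
      (\<Sum>i\<in>UNIV. \<Sum>j\<in>UNIV. indicator (band (idx j)) z *
         ((if i = j then K i0 z * F j else 0) - (if i = i0 then K j z * F i0 else 0)))"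
    unfolding hankel_symbol_def sum.distrib[symmetric]
  proof (intro sum.cong refl)
    fix i
    have "(\<Sum>j\<in>UNIV. indicator (band (idx j)) z *
        ((if i = j then K i0 z else 0) - (if i = i0 then K j z else 0))) * F i
      = (\<Sum>j\<in>UNIV. indicator (band (idx j)) z *
         ((if i = j then K i0 z * F j else 0) - (if i = i0 then K j z * F i0 else 0)))"
      unfolding sum_distrib_right mult.assoc
      by (intro sum.cong refl arg_cong[where f = "\<lambda>x. indicator (band (idx _)) z * x"])
        (auto simp: left_diff_distrib)
    then show "((if i = i0 then 1 / K i0 z else 0) + (\<Sum>j\<in>UNIV. indicator (band (idx j)) z *
        ((if i = j then K i0 z else 0) - (if i = i0 then K j z else 0)))) * F i
      = (if i = i0 then F i0 / K i0 z else 0) + (\<Sum>j\<in>UNIV. indicator (band (idx j)) z *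
         ((if i = j then K i0 z * F j else 0) - (if i = i0 then K j z * F i0 else 0)))"
      by (simp only: distrib_right) auto
  qed
  also have "(\<Sum>i\<in>UNIV. \<Sum>j\<in>UNIV. indicator (band (idx j)) z *
         ((if i = j then K i0 z * F j else 0) - (if i = i0 then K j z * F i0 else 0)))
      = (\<Sum>j\<in>UNIV. indicator (band (idx j)) z * (\<Sum>i\<in>UNIV.
         (if i = j then K i0 z * F j else 0) - (if i = i0 then K j z * F i0 else 0)))"
    by (subst sum.swap) (simp add: sum_distrib_left)
  also have "\<dots> = (\<Sum>j\<in>UNIV. indicator (band (idx j)) z * (K i0 z * F j - K j z * F i0))"
    by (simp add: sum_subtractf)
  finally show ?thesis by simp
qed

theorem mainTheorem3:
  fixes K :: "'n::finite \<Rightarrow> complex \<Rightarrow> complex"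
  assumes "inner_column K"
  shows "\<exists>Phi :: 'n \<Rightarrow> complex \<Rightarrow> complex.
           (\<forall>i. circ_measurable (Phi i)) \<and> mult_range K = hankel_kernel Phi"
proof -
  obtain i0 where nz: "AE t in circ_meas. K i0 (cis t) \<noteq> 0"
    using inner_column_component_nonzero[OF assms] by blast
  \<comment> \<open>Gives every entry a band of its own.\<close>
  obtain idx :: "'n \<Rightarrow> nat" where idx: "inj idx"
    using finite_imp_inj_to_nat_seg[of "UNIV :: 'n set"] by auto
  define Phi where "Phi = hankel_symbol idx i0 K"
  have Kinf: "hardy_inf (K i)" for i using assms by (simp add: inner_column_def)
  have KH: "circ_H1 (\<lambda>t. K i (cis t))" for i using hardy_infD(1)[OF Kinf] .
  have Kmult: "circ_H1 (\<lambda>t. K i (cis t) * G t)" if "circ_H1 G" for i G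
    using hardy_infD(2)[OF Kinf] circ_H1_mult_bounded[OF that KH] by blast
  have [measurable]: "(\<lambda>t. K i (cis t)) \<in> borel_measurable circ_meas" for i
    using circ_H1_integrable[OF KH] by (rule borel_measurable_integrable)
  have sum1: "AE t in circ_meas. (\<Sum>i\<in>UNIV. (cmod (K i (cis t)))\<^sup>2) = 1"
    using assms by (simp add: inner_column_def)
  have Pm [measurable]: "(\<lambda>t. Phi i (cis t)) \<in> borel_measurable circ_meas" for i
    unfolding Phi_def hankel_symbol_def by measurable
  have Phi_apply: "(\<Sum>i\<in>UNIV. Phi i z * F i) = F i0 / K i0 z +
     (\<Sum>j\<in>UNIV. indicator (band (idx j)) z * (K i0 z * F j - K j z * F i0))" for z F
    unfolding Phi_def by (rule hankel_symbol_apply)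
  have "F \<in> hankel_kernel Phi" if FK: "F \<in> mult_range K" for F
  proof -
    obtain g where g: "hardy 2 g" and Fg: "\<And>i. AE t in circ_meas. F i (cis t) = K i (cis t) * g (cis t)"
      using FK by (auto simp: mult_range_def)
    have gH: "circ_H1 (\<lambda>t. g (cis t))" and g2: "integrable circ_meas (\<lambda>t. (norm (g (cis t)))\<^sup>2)"
      using g by (auto simp: hardy_2_iff)
    have [measurable]: "(\<lambda>t. g (cis t)) \<in> borel_measurable circ_meas"
      using circ_H1_integrable[OF gH] by (rule borel_measurable_integrable)
    have [measurable]: "(\<lambda>t. F i (cis t)) \<in> borel_measurable circ_meas" for i
      using Fg by (rule circ_measurable_AE[rotated]) measurable
    have "hardy 2 (F i)" for i
      unfolding hardy_2_iff
    proof
      show "circ_H1 (\<lambda>t. F i (cis t))"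
        by (rule circ_H1_cong_AE[OF Kmult[OF gH, of i]]) (use Fg[of i] in auto)
      obtain C where C: "AE t in circ_meas. norm (K i (cis t)) \<le> C"
        using hardy_infD(2)[OF Kinf] by blast
      show "integrable circ_meas (\<lambda>t. (norm (F i (cis t)))\<^sup>2)"
      proof (rule Bochner_Integration.integrable_bound)
        show "integrable circ_meas (\<lambda>t. C\<^sup>2 * (norm (g (cis t)))\<^sup>2)" using g2 by auto
        show "AE t in circ_meas. norm ((norm (F i (cis t)))\<^sup>2) \<le> norm (C\<^sup>2 * (norm (g (cis t)))\<^sup>2)"
          using Fg[of i] C
          by eventually_elim (auto simp: norm_mult power_mult_distrib intro!: mult_right_mono power_mono)
      qed measurable
    qed
    moreover have "hardy 1 (\<lambda>z. \<Sum>i\<in>UNIV. Phi i z * F i z)"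
      unfolding hardy_1_iff
    proof (rule circ_H1_cong_AE[OF gH])
      have "AE t in circ_meas. \<forall>i. F i (cis t) = K i (cis t) * g (cis t)"
        using Fg by (rule eventually_all_finite)
      \<comment> \<open>All minors of \<open>K * g\<close> cancel, and the quotient of the entries
        at \<open>i0\<close> is \<open>g\<close>.\<close>
      then show "AE t in circ_meas. g (cis t) = (\<Sum>i\<in>UNIV. Phi i (cis t) * F i (cis t))"
        using nz by eventually_elim (simp add: Phi_apply)
    qed measurable
    ultimately show ?thesis by (simp add: hankel_kernel_def hardy2_vec_def)
  qed
  moreover have "F \<in> mult_range K" if "F \<in> hankel_kernel Phi" for F
  proof -
    have F2: "hardy 2 (F i)" for i using that by (simp add: hankel_kernel_def hardy2_vec_def)
    have FH: "circ_H1 (\<lambda>t. F i (cis t))" for i using F2 hardy_2_iff by blast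
    define h where "h z = (\<Sum>i\<in>UNIV. Phi i z * F i z)" for z
    have hH: "circ_H1 (\<lambda>t. h (cis t))"
      using that unfolding h_def by (simp add: hankel_kernel_def hardy_1_iff)
    have h_eq: "h z = F i0 z / K i0 z +
        (\<Sum>j\<in>UNIV. indicator (band (idx j)) z * (K i0 z * F j z - K j z * F i0 z))" for z
      unfolding h_def by (rule Phi_apply)
    \<comment> \<open>On the left half-plane every band indicator is zero, so \<open>h\<close> is
      just \<open>F i0 / K i0\<close> there; uniqueness extends the relation to the whole
      circle.\<close>
    have "AE t in circ_meas. F i0 (cis t) - K i0 (cis t) * h (cis t) = 0"
    proof (rule circ_H1_unique_arc[OF circ_H1_diff[OF FH Kmult[OF hH]]])
      show "open {z. Re z < 0}" by (rule open_halfspace_Re_lt)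
      show "cis pi \<in> {z. Re z < 0}" "pi \<in> {0<..<2*pi}" by auto
      show "AE t in circ_meas. cis t \<in> {z. Re z < 0} \<longrightarrow> F i0 (cis t) - K i0 (cis t) * h (cis t) = 0"
        using nz
      proof eventually_elim
        case (elim t)
        have "indicator (band m) (cis t) = (0::complex)" if "Re (cis t) < 0" for m
          using that band_Re_pos[of "cis t" m] by (auto simp: indicator_def)
        then show ?case using elim by (auto simp: h_eq)
      qed
    qed
    then have i0: "AE t in circ_meas. F i0 (cis t) = K i0 (cis t) * h (cis t)" by simp
    have Fj: "AE t in circ_meas. F j (cis t) = K j (cis t) * h (cis t)" for j
    proof -
      obtain s where s: "s \<in> {0<..<2*pi}" "cis s \<in> band (idx j)" using band_meets_circle by blast
      have minor: "circ_H1 (\<lambda>t. K i0 (cis t) * F j (cis t) - K j (cis t) * F i0 (cis t))"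
        using circ_H1_diff[OF Kmult[OF FH[of j], of i0] Kmult[OF FH[of i0], of j]] .
      \<comment> \<open>On the band of \<open>j\<close> only one minor contributes to
        \<open>h\<close>. The quotient term already equals \<open>h\<close> by \<open>i0\<close>, so
        that minor must vanish there, and then everywhere by uniqueness.\<close>
      have "AE t in circ_meas. K i0 (cis t) * F j (cis t) - K j (cis t) * F i0 (cis t) = 0"
      proof (rule circ_H1_unique_arc[OF minor open_band s(2,1)])
        show "AE t in circ_meas. cis t \<in> band (idx j) \<longrightarrow>
            K i0 (cis t) * F j (cis t) - K j (cis t) * F i0 (cis t) = 0"
          using nz i0
        proof eventually_elim
          case (elim t)
          show ?case
          proof
            assume t: "cis t \<in> band (idx j)"
            have "indicator (band (idx l)) (cis t) = (if l = j then 1 else 0 :: complex)" for l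
            proof (cases "l = j")
              case False
              then have "idx l \<noteq> idx j" using idx by (simp add: inj_eq)
              then have "cis t \<notin> band (idx l)" using t band_inj by blast
              then show ?thesis using False by simp
            qed (use t in simp)
            then have "h (cis t) = F i0 (cis t) / K i0 (cis t)
                + (K i0 (cis t) * F j (cis t) - K j (cis t) * F i0 (cis t))"
              by (simp add: h_eq if_distrib[of "\<lambda>x. x * _"] cong: if_cong)
            moreover have "F i0 (cis t) / K i0 (cis t) = h (cis t)" using elim by simp
            ultimately show "K i0 (cis t) * F j (cis t) - K j (cis t) * F i0 (cis t) = 0" by simp
          qed
        qed
      qed
      \<comment> \<open>Substituting \<open>F i0 = K i0 * h\<close> into the vanishing minor and
        cancelling \<open>K i0\<close>.\<close>
      then show ?thesis using nz i0 by eventually_elim auto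
    qed
    have "hardy 2 h"
      unfolding hardy_2_iff
    proof
      show "circ_H1 (\<lambda>t. h (cis t))" by (rule hH)
      have [measurable]: "(\<lambda>t. h (cis t)) \<in> borel_measurable circ_meas"
        using circ_H1_integrable[OF hH] by (rule borel_measurable_integrable)
      \<comment> \<open>The column \<open>K\<close> has norm 1 almost everywhere, so the squared
        moduli of the \<open>F i\<close> add up to that of \<open>h\<close>.\<close>
      show "integrable circ_meas (\<lambda>t. (norm (h (cis t)))\<^sup>2)"
      proof (rule integrable_cong_AE_imp)
        show "integrable circ_meas (\<lambda>t. \<Sum>i\<in>UNIV. (norm (F i (cis t)))\<^sup>2)"
          using F2 by (intro Bochner_Integration.integrable_sum) (simp add: hardy_2_iff)
        have "AE t in circ_meas. \<forall>i. F i (cis t) = K i (cis t) * h (cis t)"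
          using Fj by (rule eventually_all_finite)
        then show "AE t in circ_meas. (\<Sum>i\<in>UNIV. (norm (F i (cis t)))\<^sup>2) = (norm (h (cis t)))\<^sup>2"
          using sum1
          by eventually_elim (simp add: norm_mult power_mult_distrib sum_distrib_right[symmetric])
      qed measurable
    qed
    then show ?thesis using Fj by (auto simp: mult_range_def)
  qed
  ultimately have "mult_range K = hankel_kernel Phi" by blast
  then show ?thesis using Pm by (intro exI[of _ Phi]) (simp add: circ_measurable_def)
qed

end
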